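(* Let $E=E(\mathbf{n},\mathbf{c})$ be a uniform Cantor set with associated data $\Lambda$, $\{m_k\}_{k\in\Lambda}$, $\{s_k\}_{k\in\Lambda}$. Let $\mathbb{P}=\{P_k\}_{k=1}^\infty$ be an $\mathbf{n}$-matching sequence of positive probability vectors, and let $\mu_{\mathbb{P}}$ be the measure on $E$ determined by $\mathbb{P}$. If $\sup_{k\in\Lambda}m_k<\infty$, then $\mu_{\mathbb{P}}$ is doubling on $E$ if and only if there is a constant $C>1$ such that (a) $\mathbb{P}$ is $C$-uniform, and (b) for every $k\in\Lambda$, $(P_{k+t},P_{k+t})$ is $C$-uniform for all $1\le t<m_k$ and $(P_{k+m_k},P_{k+m_k})$ is $(C,s_k)$-uniform.
   Context: Uniform Cantor set: let $\mathbf{n}=\{n_k\}_{k\ge1}$ be integers with $n_k\geq 2$ and $\mathbf{c}=\{c_k\}_{k\ge1}$ real numbers in $(0,1)$ with $(n_k-1)c_k<1$ for all $k$. Put $E_0=[0,1]$; $E_k$ is obtained from $E_{k-1}$ by deleting from every component $I$ of $E_{k-1}$ exactly $n_k-1$ open intervals, each of length $c_k|I|$, such that the remaining $n_k$ closed intervals are of equal length. Then $E(\mathbf{n},\mathbf{c})=\bigcap_{k\ge 0}E_k$, with the metric inherited from $\mathbb{R}$. Components of $E_k$ are called components of level $k$, and components of $E_{k-1}\setminus E_k$ gaps of level $k$. The length of a component of level $k$ is $\delta_k=\prod_{i=1}^k\frac{1-(n_i-1)c_i}{n_i}$ (with $\delta_0=1$) and the length of a gap of level $k$ is $\varepsilon_k=c_k\delta_{k-1}$.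 Words: $W_k=\{i_1\cdots i_k:1\le i_j\le n_j\}$, $W_0=\{\text{empty word}\}$, and $I_{\text{empty}}=[0,1]$. Inductively, for $w\in W_{k-1}$, $I_{w1},\dots,I_{wn_k}$ denote from left to right the $n_k$ components of level $k$ contained in $I_w$. Data: $\Lambda=\{k\ge1:\varepsilon_k<\delta_k\}$. For $k\in\Lambda$, $m_k$ is the unique positive integer with $\delta_{k+m_k}\le\varepsilon_k<\delta_{k+m_k-1}$, and $s_k$ is the unique positive integer with $s_k\delta_{k+m_k}+(s_k-1)\varepsilon_{k+m_k}\le\varepsilon_k<(s_k+1)\delta_{k+m_k}+s_k\varepsilon_{k+m_k}$. Vectors: a vector $P=(p_1,\dots,p_q)$ is a positive probability vector if all $p_i>0$ and $\sum_i p_i=1$. For $C\ge1$ and an integer $1\le s\le q$, a vector $P=(p_1,\dots,p_q)$ with positive entries is $(C,s)$-uniform if $$C^{-1}\le\frac{p_{i+1}+\cdots+p_{i+l}}{p_{j+1}+\cdots+p_{j+l}}\le C$$ for all integers $i,j,l$ with $s\le l\le q$ and $0\le i\le j\le i+l\le j+l\le q$. It is $C$-uniform if it is $(C,1)$-uniform. A sequence of vectors is $C$-uniform if each of its members is. For $P=(p_1,\dots,p_q)$, $(P,P)=(p_1,\dots,p_q,p_1,\dots,p_q)$ denotes the concatenation. A sequence $\mathbb{P}=\{P_k\}_{k\ge1}$ of positive probability vectors is $\mathbf{n}$-matching if $P_k=(p_{k,1},\dots,p_{k,n_k})$ has $n_k$ entries for each $k$. Then $\mu_{\mathbb{P}}$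 is the unique Borel probability measure on $E(\mathbf{n},\mathbf{c})$ with $\mu_{\mathbb{P}}(I_{wi})=p_{k,i}\,\mu_{\mathbb{P}}(I_w)$ for all $k\ge1$, $w\in W_{k-1}$, $1\le i\le n_k$ (where $\mu_{\mathbb{P}}(I)$ means $\mu_{\mathbb{P}}(I\cap E)$). A Borel regular measure $\mu$ on a metric space $X$ is doubling if there is a constant $C\ge1$ with $0<\mu(B(x,2r))\le C\mu(B(x,r))<\infty$ for all $x\in X$ and $r>0$. *)

theory Defs
  imports "HOL-Probability.Probability"
begin

text \<open>
  Sequences indexed by the integers \<open>k \<ge> 1\<close> are functions on \<^typ>\<open>nat\<close> whose value at \<open>0\<close>
  is never used.
\<close>

definition uniform_cantor_data :: "(nat \<Rightarrow> nat) \<Rightarrow> (nat \<Rightarrow> real) \<Rightarrow> bool" where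
  "uniform_cantor_data n c \<longleftrightarrow>
     (\<forall>k\<ge>1. n k \<ge> 2 \<and> 0 < c k \<and> c k < 1 \<and> (real (n k) - 1) * c k < 1)"

definition comp_len :: "(nat \<Rightarrow> nat) \<Rightarrow> (nat \<Rightarrow> real) \<Rightarrow> nat \<Rightarrow> real" where
  "comp_len n c k = (\<Prod>i=1..k. (1 - (real (n i) - 1) * c i) / real (n i))"

definition gap_len :: "(nat \<Rightarrow> nat) \<Rightarrow> (nat \<Rightarrow> real) \<Rightarrow> nat \<Rightarrow> real" where
  "gap_len n c k = c k * comp_len n c (k - 1)"

definition words :: "(nat \<Rightarrow> nat) \<Rightarrow> nat \<Rightarrow> nat list set" where
  "words n k = {w. length w = k \<and> (\<forall>j<k. 1 \<le> w ! j \<and> w ! j \<le> n (Suc j))}"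

text \<open>
  Inside a component of level \<open>k - 1\<close>, the left endpoints of two neighbouring components of
  level \<open>k\<close> are one component and one gap apart, which gives the left endpoint of \<open>I\<^sub>w\<close> as the
  sum below. The lemmas \<open>cyl_Nil\<close>, \<open>cyl_subdivision\<close> and \<open>hole_length\<close> recover the inductive
  construction by deletion of open intervals.
\<close>

definition left_end :: "(nat \<Rightarrow> nat) \<Rightarrow> (nat \<Rightarrow> real) \<Rightarrow> nat list \<Rightarrow> real" where
  "left_end n c w =
     (\<Sum>j<length w. (real (w ! j) - 1) * (comp_len n c (Suc j) + gap_len n c (Suc j)))"

definition cyl :: "(nat \<Rightarrow> nat) \<Rightarrow> (nat \<Rightarrow> real) \<Rightarrow> nat list \<Rightarrow> real set" where
  "cyl n c w = {left_end n c w .. left_end n c w + comp_len n c (length w)}"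

definition cantor_level :: "(nat \<Rightarrow> nat) \<Rightarrow> (nat \<Rightarrow> real) \<Rightarrow> nat \<Rightarrow> real set" where
  "cantor_level n c k = (\<Union>w\<in>words n k. cyl n c w)"

definition cantor_set :: "(nat \<Rightarrow> nat) \<Rightarrow> (nat \<Rightarrow> real) \<Rightarrow> real set" where
  "cantor_set n c = (\<Inter>k. cantor_level n c k)"

definition Lambda :: "(nat \<Rightarrow> nat) \<Rightarrow> (nat \<Rightarrow> real) \<Rightarrow> nat set" where
  "Lambda n c = {k. k \<ge> 1 \<and> gap_len n c k < comp_len n c k}"

definition m_idx :: "(nat \<Rightarrow> nat) \<Rightarrow> (nat \<Rightarrow> real) \<Rightarrow> nat \<Rightarrow> nat" where
  "m_idx n c k =
     (THE m. m \<ge> 1 \<and> comp_len n c (k + m) \<le> gap_len n c k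
                    \<and> gap_len n c k < comp_len n c (k + m - 1))"

definition s_idx :: "(nat \<Rightarrow> nat) \<Rightarrow> (nat \<Rightarrow> real) \<Rightarrow> nat \<Rightarrow> nat" where
  "s_idx n c k =
     (THE s. s \<ge> 1 \<and>
        real s * comp_len n c (k + m_idx n c k) + (real s - 1) * gap_len n c (k + m_idx n c k)
          \<le> gap_len n c k \<and>
        gap_len n c k
          < (real s + 1) * comp_len n c (k + m_idx n c k) + real s * gap_len n c (k + m_idx n c k))"

definition positive_prob_vector :: "real list \<Rightarrow> bool" where
  "positive_prob_vector p \<longleftrightarrow> (\<forall>x\<in>set p. x > 0) \<and> sum_list p = 1"

definition matching :: "(nat \<Rightarrow> nat) \<Rightarrow> (nat \<Rightarrow> real list) \<Rightarrow> bool" where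
  "matching n P \<longleftrightarrow> (\<forall>k\<ge>1. length (P k) = n k)"

text \<open>
  Vectors are lists, indexed from \<open>0\<close>: the sum of \<open>p ! t\<close> over \<open>{i..<i + l}\<close> is
  \<open>p\<^sub>i\<^sub>+\<^sub>1 + \<dots> + p\<^sub>i\<^sub>+\<^sub>l\<close>, and concatenation of vectors is \<open>@\<close>.
\<close>

definition Cs_uniform :: "real \<Rightarrow> nat \<Rightarrow> real list \<Rightarrow> bool" where
  "Cs_uniform C s p \<longleftrightarrow>
     C \<ge> 1 \<and> 1 \<le> s \<and> s \<le> length p \<and> (\<forall>x\<in>set p. x > 0) \<and>
     (\<forall>i j l. s \<le> l \<and> l \<le> length p \<and> i \<le> j \<and> j \<le> i + l \<and> i + l \<le> j + l \<and> j + l \<le> length p \<longrightarrow>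
        inverse C \<le> (\<Sum>t=i..<i+l. p ! t) / (\<Sum>t=j..<j+l. p ! t) \<and>
        (\<Sum>t=i..<i+l. p ! t) / (\<Sum>t=j..<j+l. p ! t) \<le> C)"

definition C_uniform :: "real \<Rightarrow> real list \<Rightarrow> bool" where
  "C_uniform C p \<longleftrightarrow> Cs_uniform C 1 p"

definition C_uniform_seq :: "real \<Rightarrow> (nat \<Rightarrow> real list) \<Rightarrow> bool" where
  "C_uniform_seq C P \<longleftrightarrow> (\<forall>k\<ge>1. C_uniform C (P k))"

text \<open>
  The defining property of the measure determined by \<open>P\<close>: a Borel probability measure on the
  Cantor set, with space the Cantor set itself. The entry \<open>p\<^sub>k\<^sub>,\<^sub>i\<close> is \<open>P k ! (i - 1)\<close>.
\<close>

definition is_cantor_measure ::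
    "(nat \<Rightarrow> nat) \<Rightarrow> (nat \<Rightarrow> real) \<Rightarrow> (nat \<Rightarrow> real list) \<Rightarrow> real measure \<Rightarrow> bool" where
  "is_cantor_measure n c P \<mu> \<longleftrightarrow>
     prob_space \<mu> \<and> sets \<mu> = sets (restrict_space borel (cantor_set n c)) \<and>
     (\<forall>k\<ge>1. \<forall>w\<in>words n (k - 1). \<forall>i. 1 \<le> i \<and> i \<le> n k \<longrightarrow>
        measure \<mu> (cyl n c (w @ [i]) \<inter> cantor_set n c)
          = P k ! (i - 1) * measure \<mu> (cyl n c w \<inter> cantor_set n c))"

text \<open>
  Balls of the subspace \<open>X\<close> are traces of open balls of the ambient space. Borel regularity
  (every set has a Borel hull of the same outer measure) is automatic for the outer measure
  induced by a measure on the Borel \<open>\<sigma>\<close>-algebra of \<open>X\<close>, so only the latter is required.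
\<close>

definition doubling_on :: "'a::metric_space set \<Rightarrow> 'a measure \<Rightarrow> bool" where
  "doubling_on X \<mu> \<longleftrightarrow>
     sets \<mu> = sets (restrict_space borel X) \<and>
     (\<exists>C::real. C \<ge> 1 \<and> (\<forall>x\<in>X. \<forall>r>0.
        0 < emeasure \<mu> (ball x (2 * r) \<inter> X) \<and>
        emeasure \<mu> (ball x (2 * r) \<inter> X) \<le> ennreal C * emeasure \<mu> (ball x r \<inter> X) \<and>
        ennreal C * emeasure \<mu> (ball x r \<inter> X) < \<infinity>))"


subsection \<open>Consistency of the construction\<close>

lemma comp_len_0 [simp]: "comp_len n c 0 = 1"
  by (simp add: comp_len_def)

lemma comp_len_Suc:
  "comp_len n c (Suc k) = comp_len n c k * ((1 - (real (n (Suc k)) - 1) * c (Suc k)) / real (n (Suc k)))"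
  by (simp add: comp_len_def)

lemma comp_len_pos:
  assumes "uniform_cantor_data n c"
  shows "comp_len n c k > 0"
  unfolding comp_len_def
proof (rule prod_pos)
  fix i assume "i \<in> {1..k}"
  then have "n i \<ge> 2" "(real (n i) - 1) * c i < 1"
    using assms by (auto simp: uniform_cantor_data_def)
  then show "0 < (1 - (real (n i) - 1) * c i) / real (n i)" by simp
qed

lemma gap_len_pos:
  assumes "uniform_cantor_data n c" "k \<ge> 1"
  shows "gap_len n c k > 0"
  using assms comp_len_pos[OF assms(1)] by (simp add: gap_len_def uniform_cantor_data_def)

lemma comp_len_split:
  assumes "uniform_cantor_data n c"
  shows "comp_len n c k =
    real (n (Suc k)) * comp_len n c (Suc k) + (real (n (Suc k)) - 1) * gap_len n c (Suc k)"
proof -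
  have "n (Suc k) \<ge> 2" using assms by (auto simp: uniform_cantor_data_def)
  then show ?thesis by (simp add: comp_len_Suc gap_len_def field_simps)
qed

lemma comp_len_half:
  assumes "uniform_cantor_data n c"
  shows "comp_len n c (Suc k) \<le> comp_len n c k / 2"
proof -
  have n: "real (n (Suc k)) \<ge> 2" using assms by (auto simp: uniform_cantor_data_def)
  have "2 * comp_len n c (Suc k) \<le> real (n (Suc k)) * comp_len n c (Suc k)"
    using n comp_len_pos[OF assms, of "Suc k"] by simp
  moreover have "0 \<le> (real (n (Suc k)) - 1) * gap_len n c (Suc k)"
    using n gap_len_pos[OF assms, of "Suc k"] by simp
  ultimately show ?thesis using comp_len_split[OF assms, of k] by linarith
qed

lemma comp_len_strict_decreasing:
  assumes "uniform_cantor_data n c" "i < j"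
  shows "comp_len n c j < comp_len n c i"
proof -
  have "comp_len n c (Suc k) < comp_len n c k" for k
    using comp_len_half[OF assms(1), of k] comp_len_pos[OF assms(1), of k] by linarith
  then show ?thesis by (metis assms(2) lift_Suc_mono_less[of "\<lambda>k. - comp_len n c k"] neg_less_iff_less)
qed

lemma comp_len_tendsto_0:
  assumes "uniform_cantor_data n c"
  shows "comp_len n c \<longlonglongrightarrow> 0"
proof -
  have "comp_len n c k \<le> (1/2) ^ k" for k
  proof (induction k)
    case (Suc k)
    then show ?case using comp_len_half[OF assms, of k] by simp
  qed simp
  moreover have "(\<lambda>k. (1/2::real) ^ k) \<longlonglongrightarrow> 0" by (rule LIMSEQ_power_zero) simp
  ultimately show ?thesis
    using comp_len_pos[OF assms]
    by (intro tendsto_sandwich[of "\<lambda>_. 0" "comp_len n c" sequentially "\<lambda>k. (1/2) ^ k"])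
       (auto intro!: always_eventually less_imp_le)
qed

lemma ex1_m_idx:
  assumes "uniform_cantor_data n c" "k \<in> Lambda n c"
  shows "\<exists>!m. m \<ge> 1 \<and> comp_len n c (k + m) \<le> gap_len n c k
                    \<and> gap_len n c k < comp_len n c (k + m - 1)"
proof -
  have k: "k \<ge> 1" "gap_len n c k < comp_len n c k" using assms(2) by (auto simp: Lambda_def)
  have "\<forall>\<^sub>F j in sequentially. comp_len n c j < gap_len n c k"
    using order_tendstoD(2)[OF comp_len_tendsto_0[OF assms(1)] gap_len_pos[OF assms(1) k(1)]] .
  then obtain N where "\<And>j. j \<ge> N \<Longrightarrow> comp_len n c j < gap_len n c k"
    by (auto simp: eventually_sequentially)
  then have ex: "\<exists>m. comp_len n c (k + m) \<le> gap_len n c k" by (intro exI[of _ N]) (simp add: less_imp_le)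
  define m where "m = (LEAST m. comp_len n c (k + m) \<le> gap_len n c k)"
  have m: "comp_len n c (k + m) \<le> gap_len n c k" unfolding m_def using ex by (rule LeastI_ex)
  have m1: "m \<ge> 1" using m k(2) by (cases m) auto
  have "\<not> comp_len n c (k + (m - 1)) \<le> gap_len n c k"
    using m1 not_less_Least[of "m - 1" "\<lambda>m. comp_len n c (k + m) \<le> gap_len n c k", folded m_def]
    by simp
  then have m2: "gap_len n c k < comp_len n c (k + m - 1)" using m1 by simp
  show ?thesis
  proof (rule ex1I[of _ m])
    fix m' assume m': "m' \<ge> 1 \<and> comp_len n c (k + m') \<le> gap_len n c k
                    \<and> gap_len n c k < comp_len n c (k + m' - 1)"
    have mono: "comp_len n c j \<le> comp_len n c i" if "i \<le> j" for i j
      using comp_len_strict_decreasing[OF assms(1), of i j] that by (cases "i = j") auto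
    show "m' = m"
    proof (rule linorder_cases[of m' m])
      assume "m' < m"
      then have "k + m' \<le> k + m - 1" by linarith
      from mono[OF this] show ?thesis using m' m2 by linarith
    next
      assume "m < m'"
      then have "k + m \<le> k + m' - 1" by linarith
      from mono[OF this] show ?thesis using m' m by linarith
    qed
  qed (use m m1 m2 in blast)
qed

lemma ex1_s_idx:
  assumes "uniform_cantor_data n c" "k \<in> Lambda n c"
  shows "\<exists>!s. s \<ge> 1 \<and>
        real s * comp_len n c (k + m_idx n c k) + (real s - 1) * gap_len n c (k + m_idx n c k)
          \<le> gap_len n c k \<and>
        gap_len n c k
          < (real s + 1) * comp_len n c (k + m_idx n c k) + real s * gap_len n c (k + m_idx n c k)"
proof -
  define d where "d = comp_len n c (k + m_idx n c k)"
  define g where "g = gap_len n c (k + m_idx n c k)"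
  define e where "e = gap_len n c k"
  have k: "k \<ge> 1" using assms(2) by (auto simp: Lambda_def)
  have d: "d > 0" unfolding d_def using comp_len_pos[OF assms(1)] .
  have g: "g > 0" unfolding g_def using gap_len_pos[OF assms(1)] k by simp
  have "d \<le> e"
    using theI'[OF ex1_m_idx[OF assms], folded m_idx_def] unfolding d_def e_def by simp
  then have ge1: "1 \<le> (e + g) / (d + g)" using d g by simp
  have eq: "(real s * d + (real s - 1) * g \<le> e \<and> e < (real s + 1) * d + real s * g)
      \<longleftrightarrow> real s \<le> (e + g) / (d + g) \<and> (e + g) / (d + g) < real s + 1" for s
    using d g by (simp add: field_simps)
  have "\<exists>!s. s \<ge> 1 \<and> real s \<le> (e + g) / (d + g) \<and> (e + g) / (d + g) < real s + 1"
  proof (rule ex1I[of _ "nat \<lfloor>(e + g) / (d + g)\<rfloor>"])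
    show "nat \<lfloor>(e + g) / (d + g)\<rfloor> \<ge> 1 \<and> real (nat \<lfloor>(e + g) / (d + g)\<rfloor>) \<le> (e + g) / (d + g)
        \<and> (e + g) / (d + g) < real (nat \<lfloor>(e + g) / (d + g)\<rfloor>) + 1"
      using ge1 by linarith
    fix s :: nat assume "s \<ge> 1 \<and> real s \<le> (e + g) / (d + g) \<and> (e + g) / (d + g) < real s + 1"
    then show "s = nat \<lfloor>(e + g) / (d + g)\<rfloor>" by linarith
  qed
  then show ?thesis unfolding eq[symmetric] unfolding d_def e_def g_def .
qed

lemma cyl_Nil: "cyl n c [] = {0..1}"
  by (simp add: cyl_def left_end_def)

text \<open>The \<open>j\<close>-th gap inside \<open>I\<^sub>w\<close>, between the \<open>j\<close>-th and the \<open>(j + 1)\<close>-st subinterval.\<close>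

definition hole :: "(nat \<Rightarrow> nat) \<Rightarrow> (nat \<Rightarrow> real) \<Rightarrow> nat list \<Rightarrow> nat \<Rightarrow> real set" where
  "hole n c w j = {left_end n c (w @ [j]) + comp_len n c (Suc (length w)) <..< left_end n c (w @ [Suc j])}"

lemma left_end_snoc:
  "left_end n c (w @ [i]) = left_end n c w +
     (real i - 1) * (comp_len n c (Suc (length w)) + gap_len n c (Suc (length w)))"
  by (simp add: left_end_def nth_append)

lemma hole_length:
  "left_end n c (w @ [Suc j]) - (left_end n c (w @ [j]) + comp_len n c (Suc (length w)))
     = c (Suc (length w)) * comp_len n c (length w)"
  by (simp add: left_end_snoc gap_len_def algebra_simps)

lemma cyl_subdivision:
  assumes "uniform_cantor_data n c"
  shows "cyl n c w - (\<Union>j\<in>{1..<n (Suc (length w))}. hole n c w j)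
           = (\<Union>i\<in>{1..n (Suc (length w))}. cyl n c (w @ [i]))"
proof -
  define N where "N = n (Suc (length w))"
  define d where "d = comp_len n c (Suc (length w))"
  define g where "g = gap_len n c (Suc (length w))"
  define a where "a = left_end n c w"
  have N: "N \<ge> 2" using assms by (auto simp: N_def uniform_cantor_data_def)
  have d: "d > 0" unfolding d_def using comp_len_pos[OF assms] .
  have g: "g > 0" unfolding g_def using gap_len_pos[OF assms] by simp
  have cyl: "cyl n c w = {a .. a + (real N - 1) * (d + g) + d}"
    using comp_len_split[OF assms, of "length w"]
    by (simp add: cyl_def a_def N_def d_def g_def algebra_simps)
  have sub: "cyl n c (w @ [i]) = {a + (real i - 1) * (d + g) .. a + (real i - 1) * (d + g) + d}" for i
    by (simp add: cyl_def left_end_snoc a_def d_def g_def)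
  have hol: "hole n c w j = {a + (real j - 1) * (d + g) + d <..< a + real j * (d + g)}" for j
    by (simp add: hole_def left_end_snoc a_def d_def g_def)
  have "x \<in> cyl n c w - (\<Union>j\<in>{1..<N}. hole n c w j) \<longleftrightarrow> x \<in> (\<Union>i\<in>{1..N}. cyl n c (w @ [i]))" for x
  proof
    assume x: "x \<in> cyl n c w - (\<Union>j\<in>{1..<N}. hole n c w j)"
    define q where "q = nat \<lfloor>(x - a) / (d + g)\<rfloor>"
    have xa: "x \<ge> a" "x \<le> a + (real N - 1) * (d + g) + d" using x cyl by auto
    then have "0 \<le> (x - a) / (d + g)" using d g by simp
    then have "real q \<le> (x - a) / (d + g)" "(x - a) / (d + g) < real q + 1"
      unfolding q_def by linarith+
    then have q: "real q * (d + g) \<le> x - a" "x - a < (real q + 1) * (d + g)"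
      using d g by (simp_all add: field_simps)
    have "real q * (d + g) < real N * (d + g)" using q(1) xa(2) d g by (simp add: algebra_simps)
    then have qN: "q < N" using d g by simp
    have "x \<le> a + real q * (d + g) + d"
    proof (rule ccontr)
      assume A: "\<not> x \<le> a + real q * (d + g) + d"
      have "q \<noteq> N - 1"
      proof
        assume "q = N - 1"
        then have "real q = real N - 1" using N by simp
        then show False using A xa(2) by simp
      qed
      then have "Suc q \<in> {1..<N}" using qN by auto
      moreover have "x \<in> hole n c w (Suc q)" unfolding hol using A q(2) by (simp add: algebra_simps)
      ultimately show False using x by blast
    qed
    then have "x \<in> cyl n c (w @ [Suc q])" unfolding sub using q(1) by simp
    moreover have "Suc q \<in> {1..N}" using qN by simp
    ultimately show "x \<in> (\<Union>i\<in>{1..N}. cyl n c (w @ [i]))" by blast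
  next
    assume "x \<in> (\<Union>i\<in>{1..N}. cyl n c (w @ [i]))"
    then obtain i where i: "1 \<le> i" "i \<le> N"
      and x: "a + (real i - 1) * (d + g) \<le> x" "x \<le> a + (real i - 1) * (d + g) + d"
      by (auto simp: sub)
    have "0 \<le> (real i - 1) * (d + g)" using i d g by simp
    moreover have "(real i - 1) * (d + g) \<le> (real N - 1) * (d + g)"
      using i d g by (intro mult_right_mono) auto
    ultimately have "x \<in> cyl n c w" unfolding cyl using x by auto
    moreover have "x \<notin> hole n c w j" for j
    proof (cases "j < i")
      case True
      then have "real j * (d + g) \<le> (real i - 1) * (d + g)" using d g by (intro mult_right_mono) auto
      then show ?thesis unfolding hol using x by auto
    next
      case False
      then have "(real i - 1) * (d + g) \<le> (real j - 1) * (d + g)" using d g by (intro mult_right_mono) auto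
      then show ?thesis unfolding hol using x by auto
    qed
    ultimately show "x \<in> cyl n c w - (\<Union>j\<in>{1..<N}. hole n c w j)" by blast
  qed
  then show ?thesis unfolding N_def by blast
qed

end

theory Submission
  imports Defs
begin

text \<open>
Write \<open>\<delta>\<^sub>k\<close>, \<open>\<epsilon>\<^sub>k\<close> for the lengths of components and gaps of level \<open>k\<close>. Inside one component of
level \<open>j - 1\<close> the components of level \<open>j\<close> are equally spaced, and a ball of radius between \<open>\<delta>\<^sub>j\<close>
and \<open>\<delta>\<^sub>j\<^sub>-\<^sub>1\<close> traces a block of consecutive ones, a window of the vector \<open>P\<^sub>j\<close>. Doubling a radius
multiplies the length of the window by a bounded factor, so that doubling inside one
component of level \<open>j - 1\<close> is uniformity of \<open>P\<^sub>j\<close>. A ball may also cross a gap, of some level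
\<open>k < j\<close>. It then sees the end of one component of level \<open>j - 1\<close> and the beginning of the next
one, and the measure there is, up to the ratio of the masses of these two components, a copy
of \<open>(P\<^sub>j, P\<^sub>j)\<close>. Only balls of radius larger than \<open>\<epsilon>\<^sub>k\<close> cross the gap: this bounds the levels \<open>j\<close> at
which it happens by \<open>k + m\<^sub>k\<close>, and at level \<open>k + m\<^sub>k\<close> the crossing balls contain at least about \<open>s\<^sub>k\<close>
components, hence the weaker condition there.

From uniformity to doubling. Let \<open>\<delta>\<^sub>j < 2r \<le> \<delta>\<^sub>j\<^sub>-\<^sub>1\<close>. The ball \<open>B(x, 2r)\<close> meets the component of
level \<open>j - 1\<close> containing \<open>x\<close> and at most one neighbour on each side, and in each of them it
meets a window of length comparable to \<open>q = \<lceil>2r / (\<delta>\<^sub>j + \<epsilon>\<^sub>j)\<rceil>\<close>. Windows of length \<open>q\<close> around \<open>x\<close>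
have mass at most a constant times that of \<open>B(x, r)\<close> (\<open>window_le_small_ball\<close>). If the gap
towards a neighbour has level \<open>k\<close>, then \<open>\<epsilon>\<^sub>k < 2r\<close> forces \<open>k \<in> \<Lambda>\<close>, \<open>j \<le> k + m\<^sub>k\<close>, and \<open>q \<ge> s\<^sub>k\<close> if
\<open>j = k + m\<^sub>k\<close>; thus (b) compares the windows of length \<open>q\<close> on the two sides of the gap
(\<open>edge_windows\<close>). The masses of the two components themselves differ by a factor at most \<open>C\<close> for
each of the levels \<open>k, \<dots>, j - 1\<close>, and there are at most \<open>sup m\<^sub>k\<close> of these.

From doubling to uniformity. If a window has at least six components, some point of \<open>E\<close> in it
is far from both of its ends, and a ball about this point lies in the window and becomes,
after six doublings, a ball that contains every window of the same length nearby
(\<open>long_windows_comparable\<close>). This argument does not see whether the window contains the gap of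
level \<open>k\<close>, provided that this gap is at most a constant times as long as the window, and so it
covers (a) and (b). Short windows need instead that adjacent components have comparable
masses. If \<open>k \<notin> \<Lambda>\<close>, adjacent components of level \<open>k\<close> are far apart compared with their length,
and balls isolate them (\<open>entries_across_large_gap\<close>). If \<open>k \<in> \<Lambda>\<close>, compare the two components of
level \<open>k + t\<close> adjacent to a gap of level \<open>k\<close> for \<open>t < m\<^sub>k\<close>: either there is a point of \<open>E\<close> deep
inside each, and a ball about it settles the matter, or each consists of two far apart
pieces of comparable mass, and the question passes to level \<open>k + t + 1\<close>. The descent stops at
the latest when components become shorter than \<open>\<epsilon>\<^sub>k\<close>, because then balls of radius \<open>\<epsilon>\<^sub>k\<close> centred
at the ends of the gap see only one side (\<open>neighbours_comparable_within\<close>). Since it loses a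
factor at each level, \<open>sup m\<^sub>k < \<infinity>\<close> enters once more.
\<close>

section \<open>Sums over windows of a vector\<close>

definition win :: "real list \<Rightarrow> nat \<Rightarrow> nat \<Rightarrow> real" where
  "win p i l = (\<Sum>t=i..<i+l. p ! t)"

lemma win_pos:
  assumes "\<forall>x\<in>set p. x > 0" "i + l \<le> length p" "l \<ge> 1"
  shows "win p i l > 0"
  unfolding win_def using assms by (intro sum_pos) auto

lemma win_nonneg:
  assumes "\<forall>x\<in>set p. x > 0" "i + l \<le> length p"
  shows "win p i l \<ge> 0"
  unfolding win_def using assms by (intro sum_nonneg) (auto simp: less_imp_le)

lemma win_1 [simp]: "win p i (Suc 0) = p ! i"
  by (simp add: win_def)

text \<open>
Quotients and the order of the two windows disappear: uniformity is a symmetric family of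
inequalities without divisions, and a larger constant is visibly allowed.
\<close>

lemma Cs_uniform_iff:
  "Cs_uniform C s p \<longleftrightarrow> C \<ge> 1 \<and> 1 \<le> s \<and> s \<le> length p \<and> (\<forall>x\<in>set p. x > 0) \<and>
    (\<forall>i j l. s \<le> l \<longrightarrow> i + l \<le> length p \<longrightarrow> j + l \<le> length p \<longrightarrow> i \<le> j + l \<longrightarrow> j \<le> i + l \<longrightarrow>
       win p i l \<le> C * win p j l)" (is "?L \<longleftrightarrow> ?R")
proof
  assume L: ?L
  have main: "win p i l \<le> C * win p j l \<and> win p j l \<le> C * win p i l"
    if "s \<le> l" "i \<le> j" "j + l \<le> length p" "j \<le> i + l" for i j l
  proof -
    have C: "C \<ge> 1" "1 \<le> s" "\<forall>x\<in>set p. x > 0" using L by (auto simp: Cs_uniform_def)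
    have p: "win p i l > 0" "win p j l > 0" using C that by (auto intro!: win_pos)
    have "inverse C \<le> win p i l / win p j l \<and> win p i l / win p j l \<le> C"
      using L that unfolding Cs_uniform_def win_def by auto
    then show ?thesis using p C by (simp add: field_simps)
  qed
  show ?R
  proof (intro conjI allI impI)
    fix i j l assume "s \<le> l" "i + l \<le> length p" "j + l \<le> length p" "i \<le> j + l" "j \<le> i + l"
    then show "win p i l \<le> C * win p j l"
      using main[of l i j] main[of l j i] by (cases "i \<le> j") auto
  qed (use L in \<open>auto simp: Cs_uniform_def\<close>)
next
  assume R: ?R
  show ?L unfolding Cs_uniform_def
  proof (intro conjI allI impI)
    fix i j l assume a: "s \<le> l \<and> l \<le> length p \<and> i \<le> j \<and> j \<le> i + l \<and> i + l \<le> j + l \<and> j + l \<le> length p"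
    have p: "win p i l > 0" "win p j l > 0" using R a by (auto intro!: win_pos)
    have b: "win p i l \<le> C * win p j l" "win p j l \<le> C * win p i l" using R a by auto
    show "inverse C \<le> (\<Sum>t = i..<i + l. p ! t) / (\<Sum>t = j..<j + l. p ! t)"
      using p b R by (simp add: win_def field_simps)
    show "(\<Sum>t = i..<i + l. p ! t) / (\<Sum>t = j..<j + l. p ! t) \<le> C"
      using p b R by (simp add: win_def field_simps)
  qed (use R in auto)
qed

lemma Cs_uniformD:
  assumes "Cs_uniform C s p" "s \<le> l" "i + l \<le> length p" "j + l \<le> length p" "i \<le> j + l" "j \<le> i + l"
  shows "win p i l \<le> C * win p j l"
  using assms unfolding Cs_uniform_iff by blast

lemma Cs_uniform_mono:
  assumes "Cs_uniform C s p" "C \<le> C'"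
  shows "Cs_uniform C' s p"
  unfolding Cs_uniform_iff
proof (intro conjI allI impI)
  fix i j l assume a: "s \<le> l" "i + l \<le> length p" "j + l \<le> length p" "i \<le> j + l" "j \<le> i + l"
  have "win p j l \<ge> 0" using assms a by (auto simp: Cs_uniform_iff intro!: win_nonneg)
  then show "win p i l \<le> C' * win p j l"
    using Cs_uniformD[OF assms(1) a] mult_right_mono[OF assms(2), of "win p j l"] by linarith
qed (use assms in \<open>auto simp: Cs_uniform_iff\<close>)

text \<open>
Shifting a window by at most its length costs a factor \<open>C\<close>, and \<open>q\<close> such shifts reach any window
at distance at most \<open>q * l\<close>.
\<close>

lemma uniform_far_windows:
  assumes "C_uniform C p" "1 \<le> l" "i + l \<le> length p" "j + l \<le> length p" "i \<le> j + q * l"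
    "j \<le> i + q * l"
  shows "win p i l \<le> C ^ q * win p j l"
  using assms(3-6)
proof (induction q arbitrary: i)
  case 0
  then show ?case by simp
next
  case (Suc q)
  \<comment> \<open>one shift by at most \<open>l\<close> towards \<open>j\<close>\<close>
  define i' where "i' = (if i \<le> j then min j (i + l) else max j (i - l))"
  have C: "C \<ge> 1" "Cs_uniform C 1 p" using assms(1) by (auto simp: C_uniform_def Cs_uniform_def)
  have i': "i' + l \<le> length p" "i' \<le> j + q * l" "j \<le> i' + q * l" "i \<le> i' + l" "i' \<le> i + l"
    using Suc.prems by (auto simp: i'_def min_def max_def)
  have "win p i l \<le> C * win p i' l"
    using Cs_uniformD[OF C(2) assms(2), of i i'] Suc.prems i' by simp
  also have "\<dots> \<le> C * (C ^ q * win p j l)"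
    using Suc.IH[of i'] Suc.prems i' C by (intro mult_left_mono) auto
  finally show ?case by simp
qed

text \<open>
A stretch of at most \<open>q * l\<close> entries is covered by \<open>q\<close> windows of length \<open>l\<close>. The last of them may
stick out of the vector; it is moved back inside, where it still covers what it has to.
\<close>

lemma sum_le_nearby_window:
  assumes "C_uniform C p" "1 \<le> l" "j + l \<le> length p"
    and "b \<le> length p" "b \<le> a + q * l" "\<And>t. a \<le> t \<Longrightarrow> t < b \<Longrightarrow> t \<le> j + Q * l \<and> j \<le> t + Q * l"
  shows "(\<Sum>t=a..<b. p ! t) \<le> real q * (C ^ Q * win p j l)"
  using assms(4-6)
proof (induction q arbitrary: a)
  case 0
  then show ?case by simp
next
  case (Suc q)
  have C: "C \<ge> 1" "\<forall>x\<in>set p. x > 0" using assms(1) by (auto simp: C_uniform_def Cs_uniform_def)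
  have w: "win p j l \<ge> 0" using C assms by (intro win_nonneg) auto
  show ?case
  proof (cases "a < b")
    case False
    then show ?thesis using w C by simp
  next
    case True
    \<comment> \<open>the first covering window, moved back if it would leave the vector\<close>
    define s where "s = min a (length p - l)"
    have near: "s \<le> j + Q * l" "j \<le> s + Q * l" "s + l \<le> length p"
      using Suc.prems(3)[of a] True assms(3) by (auto simp: s_def min_def)
    have "(\<Sum>t=a..<b. p ! t) \<le> (\<Sum>t\<in>{s..<s+l} \<union> {a+l..<b}. p ! t)"
      using C Suc.prems(1) near True by (intro sum_mono2) (auto simp: s_def less_imp_le)
    also have "\<dots> \<le> win p s l + (\<Sum>t=a+l..<b. p ! t)"
    proof -
      have "(\<Sum>t\<in>{s..<s+l} \<inter> {a+l..<b}. p ! t) \<ge> 0"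
        using C Suc.prems(1) by (intro sum_nonneg) (auto simp: less_imp_le)
      then show ?thesis unfolding win_def by (subst sum_Un) auto
    qed
    also have "win p s l \<le> C ^ Q * win p j l"
      using uniform_far_windows[OF assms(1,2) near(3) assms(3) near(1,2)] .
    also have "(\<Sum>t=a+l..<b. p ! t) \<le> real q * (C ^ Q * win p j l)"
      using Suc.prems by (intro Suc.IH) auto
    finally show ?thesis by (simp add: algebra_simps)
  qed
qed

lemma ceiling_index:
  fixes y :: real assumes "y > 0"
  obtains h :: nat where "real h < y" "y \<le> real h + 1"
proof -
  define h where "h = nat (\<lceil>y\<rceil> - 1)"
  have "real h < y" "y \<le> real h + 1" using assms unfolding h_def by linarith+
  then show ?thesis using that by blast
qed

text \<open>
Windows of bounded length are compared entry by entry: moving one step costs a factor \<open>K\<close>, and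
the number of steps is bounded.
\<close>

lemma comparable_along_chain:
  fixes q :: "nat \<Rightarrow> real"
  assumes adj: "\<And>e. Suc e < T \<Longrightarrow> q e \<le> K * q (Suc e) \<and> q (Suc e) \<le> K * q e"
    and q: "\<And>e. e < T \<Longrightarrow> q e \<ge> 0" and K: "K \<ge> 1" and ij: "i < T" "j < T" "i \<le> j + d" "j \<le> i + d"
  shows "q i \<le> K ^ d * q j"
proof -
  have up: "q e \<le> K ^ f * q (e + f) \<and> q (e + f) \<le> K ^ f * q e" if "e + f < T" for e f
    using that
  proof (induction f)
    case (Suc f)
    have a: "q (e + f) \<le> K * q (e + Suc f)" "q (e + Suc f) \<le> K * q (e + f)"
      using adj[of "e + f"] Suc.prems by auto
    have IH: "q e \<le> K ^ f * q (e + f)" "q (e + f) \<le> K ^ f * q e" using Suc by auto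
    have "K ^ f * q (e + f) \<le> K ^ f * (K * q (e + Suc f))" "K * q (e + f) \<le> K * (K ^ f * q e)"
      using a IH K by (auto intro!: mult_left_mono)
    then show ?case using a IH by (simp add: mult_ac)
  qed simp
  have "q i \<le> K ^ (if i \<le> j then j - i else i - j) * q j"
    using up[of i "j - i"] up[of j "i - j"] ij by auto
  also have "\<dots> \<le> K ^ d * q j"
    using ij K q by (intro mult_right_mono power_increasing) auto
  finally show ?thesis .
qed

section \<open>Components, gaps and neighbours\<close>

lemma words_snoc_iff:
  "w @ [i] \<in> words n (Suc k) \<longleftrightarrow> w \<in> words n k \<and> 1 \<le> i \<and> i \<le> n (Suc k)"
  by (auto simp: words_def nth_append less_Suc_eq)

lemma words_SucE:
  assumes "w \<in> words n (Suc k)"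
  obtains v e where "w = v @ [Suc e]" "v \<in> words n k" "e < n (Suc k)"
proof -
  from assms have "length w = Suc k" by (simp add: words_def)
  then obtain v i where w: "w = v @ [i]" by (metis length_Suc_conv_rev)
  with assms have "v \<in> words n k" "1 \<le> i" "i \<le> n (Suc k)" by (simp_all add: words_snoc_iff)
  then show ?thesis using that[of v "i - 1"] w by auto
qed

lemma length_words: "w \<in> words n k \<Longrightarrow> length w = k"
  by (simp add: words_def)

locale cantor_geometry =
  fixes n :: "nat \<Rightarrow> nat" and c :: "nat \<Rightarrow> real"
  assumes data: "uniform_cantor_data n c"
begin

abbreviation "len \<equiv> comp_len n c"
abbreviation "gap \<equiv> gap_len n c"
abbreviation "lo \<equiv> left_end n c"
abbreviation "E \<equiv> cantor_set n c"

definition hi :: "nat list \<Rightarrow> real" where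
  "hi w = lo w + len (length w)"

definition pitch :: "nat \<Rightarrow> real" where
  "pitch k = len k + gap k"

lemma branches: "n (Suc k) \<ge> 2"
  using data by (auto simp: uniform_cantor_data_def)

lemmas len_pos = comp_len_pos[OF data]
lemmas gap_pos = gap_len_pos[OF data]

lemma len_mono: "i \<le> j \<Longrightarrow> len j \<le> len i"
  using comp_len_strict_decreasing[OF data, of i j] by (cases "i = j") auto

lemma len_less_iff: "len j < len i \<longleftrightarrow> i < j"
  using comp_len_strict_decreasing[OF data, of i j] len_mono[of j i] by fastforce

lemma pitch_pos: "k \<ge> 1 \<Longrightarrow> pitch k > 0"
  using len_pos[of k] gap_pos[of k] by (simp add: pitch_def)

lemma len_split: "len k = real (n (Suc k)) * pitch (Suc k) - gap (Suc k)"
  using comp_len_split[OF data, of k] by (simp add: pitch_def algebra_simps)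

lemma cyl_eq: "cyl n c w = {lo w..hi w}"
  by (simp add: cyl_def hi_def)

lemma lo_le_hi: "lo w \<le> hi w"
  using len_pos[of "length w"] by (simp add: hi_def)

text \<open>
Pieces \<open>w @ [Suc e]\<close> are counted by \<open>e\<close> from \<open>0\<close>, like the entries of the vectors, although the
letters of words start at \<open>1\<close>.
\<close>

lemma lo_piece: "lo (w @ [Suc e]) = lo w + real e * pitch (Suc (length w))"
  by (simp add: left_end_snoc pitch_def)

lemma hi_piece: "hi (w @ [Suc e]) = lo w + real e * pitch (Suc (length w)) + len (Suc (length w))"
  by (simp add: hi_def lo_piece)

text \<open>
The subdivision of a component is flush with both of its ends, so that following first
(last) subcomponents never moves the left (right) endpoint.
\<close>

lemma hi_last_piece: "hi (w @ [n (Suc (length w))]) = hi w"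
proof -
  obtain N where N: "n (Suc (length w)) = Suc N" using branches[of "length w"]
    by (cases "n (Suc (length w))") auto
  show ?thesis
    using len_split[of "length w"] by (simp add: N lo_piece hi_def pitch_def algebra_simps)
qed

lemma lo_first_piece: "lo (w @ [Suc 0]) = lo w"
  by (simp add: lo_piece)

lemma piece_index_mono:
  assumes "e \<le> f" shows "real e * pitch (Suc k) \<le> real f * pitch (Suc k)"
  using assms pitch_pos[of "Suc k"] by (intro mult_right_mono) auto

lemma piece_within:
  assumes "e < n (Suc (length w))"
  shows "lo w \<le> lo (w @ [Suc e])" "hi (w @ [Suc e]) \<le> hi w"
proof -
  show "lo w \<le> lo (w @ [Suc e])" using pitch_pos[of "Suc (length w)"] by (simp add: lo_piece)
  obtain N where N: "n (Suc (length w)) = Suc N" using branches[of "length w"]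
    by (cases "n (Suc (length w))") auto
  have "hi (w @ [Suc e]) \<le> hi (w @ [Suc N])"
    using assms N piece_index_mono[of e N "length w"] by (simp add: hi_piece)
  then show "hi (w @ [Suc e]) \<le> hi w" using hi_last_piece[of w] N by simp
qed

lemma cyl_piece_subset:
  "e < n (Suc (length w)) \<Longrightarrow> cyl n c (w @ [Suc e]) \<subseteq> cyl n c w"
  using piece_within[of e w] by (simp add: cyl_eq)

lemma hi_piece_less:
  assumes "e < f"
  shows "hi (w @ [Suc e]) + gap (Suc (length w)) \<le> lo (w @ [Suc f])"
  using piece_index_mono[of "Suc e" f "length w"] assms
  by (simp add: hi_piece lo_piece pitch_def algebra_simps)

text \<open>
A point in two components of the same level would, by induction, have a common parent, and
siblings are separated by gaps.
\<close>

lemma cyl_inj: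
  assumes "w \<in> words n k" "v \<in> words n k" "x \<in> cyl n c w" "x \<in> cyl n c v"
  shows "w = v"
  using assms
proof (induction k arbitrary: w v)
  case 0
  then show ?case by (simp add: words_def)
next
  case (Suc k)
  obtain w' e where w: "w = w' @ [Suc e]" "w' \<in> words n k" "e < n (Suc k)"
    using words_SucE[OF Suc.prems(1)] .
  obtain v' f where v: "v = v' @ [Suc f]" "v' \<in> words n k" "f < n (Suc k)"
    using words_SucE[OF Suc.prems(2)] .
  have l: "length w' = k" "length v' = k" using w v length_words by auto
  have "x \<in> cyl n c w'" "x \<in> cyl n c v'"
    using Suc.prems(3,4) cyl_piece_subset[of e w'] cyl_piece_subset[of f v'] w v l by auto
  then have eq: "w' = v'" using Suc.IH w v by blast
  have "\<not> e < f" "\<not> f < e"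
    using Suc.prems(3,4) hi_piece_less[of e f w'] hi_piece_less[of f e w'] gap_pos[of "Suc k"]
    unfolding w v eq[symmetric] cyl_eq l by auto
  then show ?case using w v eq by simp
qed

lemma E_cyl:
  assumes "x \<in> E"
  obtains w where "w \<in> words n k" "x \<in> cyl n c w"
  using assms unfolding cantor_set_def cantor_level_def by blast

lemma E_piece:
  assumes "x \<in> E" "w \<in> words n k" "x \<in> cyl n c w"
  obtains e where "e < n (Suc k)" "x \<in> cyl n c (w @ [Suc e])"
proof -
  obtain v where v: "v \<in> words n (Suc k)" "x \<in> cyl n c v" using E_cyl[OF assms(1)] .
  obtain w' e where w': "v = w' @ [Suc e]" "w' \<in> words n k" "e < n (Suc k)"
    using words_SucE[OF v(1)] .
  have "x \<in> cyl n c w'" using cyl_piece_subset[of e w'] w' v length_words[OF w'(2)] by auto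
  then have "w' = w" using cyl_inj assms w' by blast
  then show ?thesis using that w' v by blast
qed

lemma E_bounds: "x \<in> E \<Longrightarrow> 0 \<le> x \<and> x \<le> 1"
  by (erule E_cyl[where k = 0]) (simp add: words_def cyl_Nil)

lemma words_prefix_cyl:
  assumes "w \<in> words n (k + j)" "x \<in> cyl n c w"
  shows "\<exists>v\<in>words n k. x \<in> cyl n c v"
  using assms
proof (induction j arbitrary: w)
  case (Suc j)
  obtain v e where v: "w = v @ [Suc e]" "v \<in> words n (k + j)" "e < n (Suc (k + j))"
    using words_SucE[of w n "k + j"] Suc.prems(1) by auto
  have "x \<in> cyl n c v"
    using Suc.prems(2) v cyl_piece_subset[of e v] length_words[OF v(2)] by auto
  then show ?case using Suc.IH v by blast
qed auto

lemma pos_in_piece: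
  assumes "length w = k" "y \<in> cyl n c (w @ [Suc e])"
  shows "lo w + real e * pitch (Suc k) \<le> y" "y \<le> lo w + real e * pitch (Suc k) + len (Suc k)"
  using assms by (simp_all add: cyl_eq hi_piece lo_piece)

lemma len_le_pitch: "len (Suc k) \<le> pitch (Suc k)"
  using gap_pos[of "Suc k"] by (simp add: pitch_def)

definition last_ext :: "nat \<Rightarrow> nat \<Rightarrow> nat list" where
  "last_ext k t = map n [Suc k..<Suc (k + t)]"

lemma last_ext_0 [simp]: "last_ext k 0 = []"
  by (simp add: last_ext_def)

lemma last_ext_Suc: "last_ext k (Suc t) = last_ext k t @ [n (Suc (k + t))]"
  by (simp add: last_ext_def)

lemma length_last_ext [simp]: "length (last_ext k t) = t"
  by (simp add: last_ext_def)

lemma replicate_snoc: "replicate (Suc t) a = replicate t a @ [a]"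
  by (metis replicate_Suc replicate_append_same)

lemma first_descendant:
  assumes "w \<in> words n k"
  shows "w @ replicate t 1 \<in> words n (k + t)" "lo (w @ replicate t 1) = lo w"
proof (induction t)
  case (Suc t)
  have eq: "w @ replicate (Suc t) 1 = (w @ replicate t 1) @ [Suc 0]"
    by (simp only: replicate_snoc append_assoc One_nat_def)
  { case 1 then show ?case using Suc(1) branches[of "k + t"]
    by (simp only: eq words_snoc_iff add_Suc_right) simp }
  { case 2 then show ?case using Suc(2) by (simp only: eq lo_first_piece) }
qed (use assms in auto)

lemma last_descendant:
  assumes "w \<in> words n k"
  shows "w @ last_ext k t \<in> words n (k + t)" "hi (w @ last_ext k t) = hi w"
proof (induction t)
  case (Suc t)
  have eq: "w @ last_ext k (Suc t) = (w @ last_ext k t) @ [n (Suc (k + t))]"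
    by (simp add: last_ext_Suc)
  { case 1 then show ?case using Suc(1) branches[of "k + t"]
    by (simp only: eq words_snoc_iff add_Suc_right) simp }
  { case 2 then show ?case
      using Suc hi_last_piece[of "w @ last_ext k t"] length_words[OF Suc(1)] by (simp only: eq) }
qed (use assms in auto)

lemma E_I:
  assumes "\<And>t. \<exists>v\<in>words n (k + t). x \<in> cyl n c v"
  shows "x \<in> E"
  unfolding cantor_set_def cantor_level_def
proof (rule INT_I)
  fix j
  have "\<exists>v\<in>words n (j + k). x \<in> cyl n c v" using assms[of j] by (simp add: add.commute)
  then show "x \<in> (\<Union>w\<in>words n j. cyl n c w)" using words_prefix_cyl[of _ j k x] by blast
qed

text \<open>
The left endpoint of a component is the left endpoint of all its first descendants.
\<close>

lemma lo_in_E: "w \<in> words n k \<Longrightarrow> lo w \<in> E"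
proof (rule E_I[of k])
  fix t assume w: "w \<in> words n k"
  show "\<exists>v\<in>words n (k + t). lo w \<in> cyl n c v"
    using first_descendant[OF w, of t] lo_le_hi[of "w @ replicate t 1"]
      by (intro bexI[of _ "w @ replicate t 1"]) (simp_all add: cyl_eq)
qed

lemma hi_in_E: "w \<in> words n k \<Longrightarrow> hi w \<in> E"
proof (rule E_I[of k])
  fix t assume w: "w \<in> words n k"
  show "\<exists>v\<in>words n (k + t). hi w \<in> cyl n c v"
    using last_descendant[OF w, of t] lo_le_hi[of "w @ last_ext k t"] by (auto simp: cyl_eq)
qed

lemma lo_leftmost: "lo (replicate k 1) = 0" and leftmost_word: "replicate k 1 \<in> words n k"
  using first_descendant[of "[]" 0 k] by (auto simp: words_def left_end_def)

lemma hi_rightmost: "hi (last_ext 0 k) = 1" and rightmost_word: "last_ext 0 k \<in> words n k"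
  using last_descendant[of "[]" 0 k] by (auto simp: words_def left_end_def hi_def)

text \<open>
Two components of level \<open>k + t\<close> with no other component of that level between them, separated
by a gap of level \<open>k\<close>: their ancestors of level \<open>k\<close> are adjacent siblings, and below level \<open>k\<close> the
left word runs through the last and the right word through the first subcomponents.
\<close>

definition neighbours :: "nat \<Rightarrow> nat \<Rightarrow> nat list \<Rightarrow> nat list \<Rightarrow> bool" where
  "neighbours k t v v' \<longleftrightarrow> k \<ge> 1 \<and> (\<exists>z\<in>words n (k - 1). \<exists>i. Suc i < n k \<and>
     v = z @ [Suc i] @ last_ext k t \<and> v' = z @ [Suc (Suc i)] @ replicate t 1)"

lemma neighbours_Suc:
  assumes "neighbours k t v v'"
  shows "neighbours k (Suc t) (v @ [n (Suc (k + t))]) (v' @ [Suc 0])"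
  using assms unfolding neighbours_def
    by (auto simp: last_ext_Suc replicate_snoc simp del: replicate_Suc)

lemma neighbours_SucE:
  assumes "neighbours k (Suc t) v v'"
  obtains u u' where "v = u @ [n (Suc (k + t))]" "v' = u' @ [Suc 0]" "neighbours k t u u'"
proof -
  from assms obtain z i where z: "k \<ge> 1" "z\<in>words n (k - 1)" "Suc i < n k"
     "v = z @ [Suc i] @ last_ext k (Suc t)" "v' = z @ [Suc (Suc i)] @ replicate (Suc t) 1"
    unfolding neighbours_def by blast
  have "neighbours k t (z @ [Suc i] @ last_ext k t) (z @ [Suc (Suc i)] @ replicate t 1)"
    using z unfolding neighbours_def by blast
  moreover have "v = (z @ [Suc i] @ last_ext k t) @ [n (Suc (k + t))]"
    by (simp add: z last_ext_Suc)
  moreover have "v' = (z @ [Suc (Suc i)] @ replicate t 1) @ [Suc 0]"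
    by (simp add: z replicate_snoc del: replicate_Suc)
  ultimately show ?thesis using that by blast
qed

lemma neighbours_0:
  assumes "z \<in> words n k" "Suc i < n (Suc k)"
  shows "neighbours (Suc k) 0 (z @ [Suc i]) (z @ [Suc (Suc i)])"
  using assms unfolding neighbours_def by auto

lemma neighbours_props:
  assumes "neighbours k t v v'"
  shows "k \<ge> 1" "v \<in> words n (k + t)" "v' \<in> words n (k + t)" "lo v' = hi v + gap k"
    "\<And>y. y \<in> E \<Longrightarrow> y \<le> hi v \<or> lo v' \<le> y"
proof -
  from assms obtain z i where z: "z \<in> words n (k - 1)" "Suc i < n k"
     "v = z @ [Suc i] @ last_ext k t" "v' = z @ [Suc (Suc i)] @ replicate t 1" and k: "k \<ge> 1"
    unfolding neighbours_def by blast
  have lz: "Suc (length z) = k" using k z length_words by fastforce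
  have a: "z @ [Suc i] \<in> words n k" "z @ [Suc (Suc i)] \<in> words n k"
    using z k words_snoc_iff[of z "Suc i" n "k - 1"] words_snoc_iff[of z "Suc (Suc i)" n "k - 1"] by auto
  show "k \<ge> 1" by fact
  show "v \<in> words n (k + t)" "v' \<in> words n (k + t)"
    using last_descendant(1)[OF a(1), of t] first_descendant(1)[OF a(2), of t] z by auto
  have hv: "hi v = hi (z @ [Suc i])" using last_descendant(2)[OF a(1), of t] z by simp
  have lv: "lo v' = lo (z @ [Suc (Suc i)])" using first_descendant(2)[OF a(2), of t] z by simp
  show "lo v' = hi v + gap k" unfolding hv lv
    by (simp add: hi_piece lo_piece lz pitch_def algebra_simps)
  fix y assume y: "y \<in> E"
  show "y \<le> hi v \<or> lo v' \<le> y"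
  proof (rule ccontr)
    assume "\<not> ?thesis"
    then have c: "hi v < y" "y < lo v'" by auto
    have "y \<in> cyl n c z"
      using c piece_within[of i z] piece_within[of "Suc i" z] lo_le_hi[of "z @ [Suc i]"]
        lo_le_hi[of "z @ [Suc (Suc i)]"] z lz unfolding hv lv by (auto simp: cyl_eq)
    then obtain e where e: "e < n (Suc (k - 1))" "y \<in> cyl n c (z @ [Suc e])"
      using E_piece[OF y z(1)] by blast
    have "e \<le> i \<or> Suc i \<le> e" by linarith
    then show False
    proof
      assume "e \<le> i"
      then show False using e c(1) piece_index_mono[of e i "k - 1"] k lz
        unfolding hv by (simp add: cyl_eq hi_piece)
    next
      assume "Suc i \<le> e"
      then show False using e c(2) piece_index_mono[of "Suc i" e "k - 1"] k lz
        unfolding lv by (simp add: cyl_eq lo_piece)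
    qed
  qed
qed

lemma ex_neighbours:
  assumes "k \<ge> 1" shows "\<exists>v v'. neighbours k t v v'"
proof (induction t)
  case 0
  obtain k' where k: "k = Suc k'" using assms by (cases k) auto
  show ?case using neighbours_0[OF leftmost_word[of k'], of 0] branches[of k'] k by auto
next
  case (Suc t)
  then show ?case using neighbours_Suc by blast
qed

text \<open>
Two components of level \<open>j\<close> with a third one between them have distance at least \<open>\<delta>\<^sub>j\<close>. Along the
words: the parents are equal or, by induction, neighbours. Equal parents force adjacent
siblings; neighbouring parents force the last subcomponent on the left and the first one on
the right, since otherwise a whole subcomponent fits in between.
\<close>

lemma close_points_neighbours:
  assumes "v \<in> words n j" "v' \<in> words n j" "v \<noteq> v'" "x \<in> cyl n c v" "y \<in> cyl n c v'"
    "x < y" "y - x < len j"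
  shows "\<exists>k t. neighbours k t v v' \<and> j = k + t"
  using assms
proof (induction j arbitrary: v v')
  case 0
  then show ?case by (simp add: words_def)
next
  case (Suc j)
  obtain w e where w: "v = w @ [Suc e]" "w \<in> words n j" "e < n (Suc j)"
    using words_SucE[OF Suc.prems(1)] .
  obtain w' f where w': "v' = w' @ [Suc f]" "w' \<in> words n j" "f < n (Suc j)"
    using words_SucE[OF Suc.prems(2)] .
  have l: "length w = j" "length w' = j" using w w' length_words by auto
  show ?case
  proof (cases "w = w'")
    case True
    have "e \<noteq> f" using True w w' Suc.prems(3) by auto
    moreover have "\<not> f < e"
      using Suc.prems(4-6) hi_piece_less[of f e w] gap_pos[of "Suc j"] l
        unfolding w w' True[symmetric]
      by (auto simp: cyl_eq)
    ultimately have ef: "e < f" by simp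
    have "f = Suc e"
    proof (rule ccontr)
      assume "f \<noteq> Suc e"
      then have "real (e + 2) * pitch (Suc j) \<le> real f * pitch (Suc j)"
        using ef by (intro piece_index_mono) auto
      then show False
        using Suc.prems(4-7) gap_pos[of "Suc j"] l unfolding w w' True[symmetric]
        by (auto simp: cyl_eq hi_piece lo_piece pitch_def algebra_simps)
    qed
    then have "neighbours (Suc j) 0 v v'"
      using neighbours_0[OF w(2), of e] w w' True by simp
    then show ?thesis by (intro exI[of _ "Suc j"] exI[of _ 0]) simp
  next
    case False
    have x: "x \<in> cyl n c w" and y: "y \<in> cyl n c w'"
      using Suc.prems(4,5) w w' cyl_piece_subset[of e w] cyl_piece_subset[of f w'] l by auto
    have lj: "len (Suc j) \<le> len j" by (rule len_mono) simp
    obtain k t where kt: "neighbours k t w w'" "j = k + t"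
      using Suc.IH[OF w(2) w'(2) False x y Suc.prems(6)] Suc.prems(7) lj by auto
    note np = neighbours_props[OF kt(1)]
    have g: "gap k > 0" using np(1) gap_pos by blast
    have "Suc e = n (Suc j)"
    proof (rule ccontr)
      assume "Suc e \<noteq> n (Suc j)"
      then have "Suc e < n (Suc j)" using w by simp
      then have "hi v + gap (Suc j) + len (Suc j) \<le> hi w"
        using hi_piece_less[of e "Suc e" w] piece_within(2)[of "Suc e" w] l w
          by (simp add: hi_def)
      then show False using Suc.prems(4-7) np(4) y g gap_pos[of "Suc j"] by (auto simp: cyl_eq)
    qed
    moreover have "f = 0"
    proof (rule ccontr)
      assume "f \<noteq> 0"
      then have "lo w' + len (Suc j) + gap (Suc j) \<le> lo v'"
        using hi_piece_less[of 0 f w'] l w' by (simp add: hi_def lo_first_piece)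
      then show False using Suc.prems(4-7) np(4) x g gap_pos[of "Suc j"] by (auto simp: cyl_eq)
    qed
    ultimately have "neighbours k (Suc t) v v'"
      using neighbours_Suc[OF kt(1)] w w' kt(2) by simp
    then show ?thesis using kt(2) by (intro exI[of _ k] exI[of _ "Suc t"]) simp
  qed
qed

text \<open>
The gap next to a component is free of points of \<open>E\<close>, so that the left endpoint of neither
candidate lies before that of the other.
\<close>

lemma right_neighbour_unique:
  assumes "neighbours k t v v'" "neighbours k' t' v v''" "k + t = k' + t'"
  shows "v' = v''"
proof -
  note a = neighbours_props[OF assms(1)] note b = neighbours_props[OF assms(2)]
  have "lo v' = lo v''"
    using a(4) b(4) a(5)[OF lo_in_E[OF b(3)]] b(5)[OF lo_in_E[OF a(3)]] gap_pos[OF a(1)] gap_pos[OF b(1)]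
    by linarith
  then have "lo v' \<in> cyl n c v''" "lo v' \<in> cyl n c v'"
    using lo_le_hi[of v''] lo_le_hi[of v'] by (auto simp: cyl_eq)
  then show ?thesis using cyl_inj a(3) b(3) assms(3) by metis
qed

lemma left_neighbour_unique:
  assumes "neighbours k t v' v" "neighbours k' t' v'' v" "k + t = k' + t'"
  shows "v' = v''"
proof -
  note a = neighbours_props[OF assms(1)] note b = neighbours_props[OF assms(2)]
  have "hi v' = hi v''"
    using a(4) b(4) a(5)[OF hi_in_E[OF b(2)]] b(5)[OF hi_in_E[OF a(2)]] gap_pos[OF a(1)] gap_pos[OF b(1)]
    by linarith
  then have "hi v' \<in> cyl n c v''" "hi v' \<in> cyl n c v'"
    using lo_le_hi[of v''] lo_le_hi[of v'] by (auto simp: cyl_eq)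
  then show ?thesis using cyl_inj a(2) b(2) assms(3) by metis
qed

lemma m_idx_props:
  assumes "k \<in> Lambda n c"
  shows "m_idx n c k \<ge> 1" "len (k + m_idx n c k) \<le> gap k" "gap k < len (k + m_idx n c k - 1)"
  using theI'[OF ex1_m_idx[OF data assms], folded m_idx_def] by auto

text \<open>
A block of \<open>s\<^sub>k\<close> components of level \<open>k + m\<^sub>k\<close> is not longer than \<open>\<epsilon>\<^sub>k\<close>, hence shorter than a
component of level \<open>k + m\<^sub>k - 1\<close>; therefore it does not exhaust its parent.
\<close>

lemma s_idx_props:
  fixes k defines "j \<equiv> k + m_idx n c k" and "s \<equiv> s_idx n c k"
  assumes "k \<in> Lambda n c"
  shows "s \<ge> 1" "(real s - 1) * pitch j + len j \<le> gap k" "gap k < real s * pitch j + len j"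
    "s < n j"
proof -
  note p = theI'[OF ex1_s_idx[OF data assms(3)], folded s_idx_def, folded j_def s_def]
  show "s \<ge> 1" using p by blast
  show 1: "(real s - 1) * pitch j + len j \<le> gap k" using p by (simp add: pitch_def algebra_simps)
  show "gap k < real s * pitch j + len j" using p by (simp add: pitch_def algebra_simps)
  have j: "j = Suc (j - 1)" using m_idx_props(1)[OF assms(3)] by (simp add: j_def)
  have "(real s - 1) * pitch j + len j < real (n j) * pitch j - gap j"
    using 1 m_idx_props(3)[OF assms(3), folded j_def] len_split[of "j - 1"] j by simp
  then have "real s * pitch j < real (n j) * pitch j" by (simp add: pitch_def algebra_simps)
  then show "s < n j" using pitch_pos[of j] j by (simp add: mult_less_cancel_right)
qed

text \<open>
Three or more equally spaced pieces always have one that starts not far from the middle; for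
two pieces, the inner end of the first one serves, unless the gap is so long that the two
pieces are clustered at the ends of the component.
\<close>

lemma central_point:
  assumes w: "w \<in> words n k" and ne: "\<not> (n (Suc k) = 2 \<and> Suc k \<notin> Lambda n c)"
  shows "\<exists>x\<in>E. lo w + len k / 4 \<le> x \<and> x \<le> hi w - len k / 4"
proof -
  define N where "N = n (Suc k)"
  define p where "p = pitch (Suc k)"
  have lw: "length w = k" using w length_words by blast
  have N: "N \<ge> 2" using branches by (simp add: N_def)
  have p: "p > 0" using pitch_pos by (simp add: p_def)
  have lk: "len k = real N * p - gap (Suc k)" using len_split by (simp add: N_def p_def)
  have g: "gap (Suc k) > 0" "gap (Suc k) < p"
    using gap_pos[of "Suc k"] len_pos[of "Suc k"] by (auto simp: p_def pitch_def)
  show ?thesis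
  proof (cases "N = 2")
    case True
    then have "gap (Suc k) < len (Suc k)" using ne by (auto simp: N_def Lambda_def)
    moreover have "hi (w @ [Suc 0]) \<in> E"
      using w N by (intro hi_in_E[of _ "Suc k"]) (auto simp: words_snoc_iff N_def)
    moreover have "hi (w @ [Suc 0]) = lo w + len (Suc k)" by (simp add: hi_piece lw)
    moreover have "len k = 2 * len (Suc k) + gap (Suc k)"
      using lk True by (simp add: p_def pitch_def)
    ultimately have "hi (w @ [Suc 0]) \<in> E" "lo w + len k / 4 \<le> hi (w @ [Suc 0])"
      "hi (w @ [Suc 0]) \<le> lo w + len k - len k / 4"
      using g by argo+
    then show ?thesis by (auto simp: hi_def lw)
  next
    case False
    define e where "e = N div 2"
    have "e < N" "N \<le> 4 * e" "N + 4 * e + 4 \<le> 4 * N" using N False unfolding e_def by arith+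
    then have e: "e < N" "real N \<le> 4 * real e" "real N + 4 * real e + 4 \<le> 4 * real N" by linarith+
    have "lo (w @ [Suc e]) \<in> E"
      using w e by (intro lo_in_E[of _ "Suc k"]) (auto simp: words_snoc_iff N_def)
    moreover define X Y where "X = real e * p" and "Y = real N * p"
    have "real N * p \<le> (4 * real e) * p" "(real N + 4 * real e + 4) * p \<le> (4 * real N) * p"
      using e p by (auto intro!: mult_right_mono)
    then have "Y \<le> 4 * X" "Y + 4 * X + 4 * p \<le> 4 * Y" by (simp_all add: X_def Y_def distrib_right)
    moreover have "lo (w @ [Suc e]) = lo w + X" by (simp add: lo_piece lw p_def X_def)
    moreover have "hi w = lo w + len k" "len k = Y - gap (Suc k)"
      by (simp_all add: hi_def lw lk Y_def)
    ultimately show ?thesis using g by (intro bexI[of _ "lo (w @ [Suc e])"] conjI) argo+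
  qed
qed

end

section \<open>The mass of a component\<close>

locale cantor_measure = cantor_geometry +
  fixes P :: "nat \<Rightarrow> real list" and \<mu> :: "real measure"
  assumes prob_vectors: "\<forall>k\<ge>1. positive_prob_vector (P k)"
    and matching: "matching n P"
    and cantor_measure: "is_cantor_measure n c P \<mu>"
begin

text \<open>
The measure lives on \<open>E\<close> with the traces of Borel sets. As a function of subsets of the line
it can be applied to balls and intervals directly.
\<close>

definition mass :: "real set \<Rightarrow> real" where
  "mass A = measure \<mu> (A \<inter> E)"

lemma prob: "prob_space \<mu>"
  using cantor_measure by (simp add: is_cantor_measure_def)

lemma sets_mu: "sets \<mu> = sets (restrict_space borel E)"
  using cantor_measure by (simp add: is_cantor_measure_def)

lemma trace_in_sets: "A \<in> sets borel \<Longrightarrow> A \<inter> E \<in> sets \<mu>"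
  by (auto simp: sets_mu sets_restrict_space)

lemma space_mu: "space \<mu> = E"
  using sets_eq_imp_space_eq[OF sets_mu] by (simp add: space_restrict_space)

lemma mass_nonneg [simp]: "mass A \<ge> 0"
  by (simp add: mass_def)

lemma emeasure_mass: "emeasure \<mu> (A \<inter> E) = ennreal (mass A)"
proof -
  interpret prob_space \<mu> by (rule prob)
  show ?thesis by (simp add: mass_def emeasure_eq_measure)
qed

lemma mass_mono:
  assumes "\<And>y. y \<in> E \<Longrightarrow> y \<in> A \<Longrightarrow> y \<in> B" "B \<in> sets borel"
  shows "mass A \<le> mass B"
proof -
  interpret prob_space \<mu> by (rule prob)
  show ?thesis unfolding mass_def
    using assms trace_in_sets by (intro finite_measure_mono) auto
qed

lemma mass_subadd:
  assumes "A \<in> sets borel" "B \<in> sets borel"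
  shows "mass (A \<union> B) \<le> mass A + mass B"
proof -
  interpret prob_space \<mu> by (rule prob)
  show ?thesis unfolding mass_def Int_Un_distrib2
    using assms trace_in_sets by (intro measure_subadditive) (auto simp: emeasure_eq_measure)
qed

lemma mass_Union:
  assumes "finite S" "\<And>e. e \<in> S \<Longrightarrow> A e \<in> sets borel" "disjoint_family_on A S"
  shows "mass (\<Union>e\<in>S. A e) = (\<Sum>e\<in>S. mass (A e))"
proof -
  interpret prob_space \<mu> by (rule prob)
  have "mass (\<Union>e\<in>S. A e) = prob (\<Union>e\<in>S. A e \<inter> E)" by (simp add: mass_def)
  also have "\<dots> = (\<Sum>e\<in>S. prob (A e \<inter> E))"
    using assms trace_in_sets by (intro finite_measure_finite_Union) (auto simp: disjoint_family_on_def)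
  finally show ?thesis by (simp add: mass_def)
qed

abbreviation M :: "nat list \<Rightarrow> real" where "M w \<equiv> mass (cyl n c w)"

lemma cyl_borel [simp]: "cyl n c w \<in> sets borel"
  by (simp add: cyl_def)

lemma length_P: "length (P (Suc k)) = n (Suc k)"
  using matching by (simp add: matching_def)

lemma length_P': "k \<ge> 1 \<Longrightarrow> length (P k) = n k"
  using matching by (simp add: matching_def)

lemma P_vector: "\<forall>x\<in>set (P (Suc k)). x > 0" "sum_list (P (Suc k)) = 1"
  using prob_vectors[rule_format, of "Suc k"] by (auto simp: positive_prob_vector_def)

lemma P_pos: "e < n (Suc k) \<Longrightarrow> P (Suc k) ! e > 0"
  using P_vector(1)[of k] length_P[of k] by auto

lemma P_sum: "(\<Sum>e<n (Suc k). P (Suc k) ! e) = 1"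
  using P_vector(2)[of k] length_P[of k] by (simp add: sum_list_sum_nth atLeast0LessThan)

lemma M_piece:
  assumes "w \<in> words n k" "e < n (Suc k)"
  shows "M (w @ [Suc e]) = P (Suc k) ! e * M w"
proof -
  have "\<forall>k\<ge>1. \<forall>w\<in>words n (k - 1). \<forall>i. 1 \<le> i \<and> i \<le> n k \<longrightarrow>
        measure \<mu> (cyl n c (w @ [i]) \<inter> E) = P k ! (i - 1) * measure \<mu> (cyl n c w \<inter> E)"
    using cantor_measure by (simp add: is_cantor_measure_def)
  from this[rule_format, of "Suc k" w "Suc e"] assms show ?thesis by (simp add: mass_def)
qed

lemma M_Nil: "M [] = 1"
proof -
  interpret prob_space \<mu> by (rule prob)
  have "cyl n c [] \<inter> E = space \<mu>" using E_bounds by (auto simp: cyl_Nil space_mu)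
  then show ?thesis by (simp add: mass_def prob_space)
qed

lemma M_pos: "w \<in> words n k \<Longrightarrow> M w > 0"
proof (induction k arbitrary: w)
  case 0
  then show ?case using M_Nil by (simp add: words_def)
next
  case (Suc k)
  then obtain v e where "w = v @ [Suc e]" "v \<in> words n k" "e < n (Suc k)" using words_SucE
    by blast
  then show ?case using Suc.IH M_piece P_pos by simp
qed

lemma pieces_disjoint: "disjoint_family_on (\<lambda>e. cyl n c (w @ [Suc e])) S"
proof -
  have "cyl n c (w @ [Suc e]) \<inter> cyl n c (w @ [Suc f]) = {}" if "e < f" for e f
    using hi_piece_less[OF that, of w] gap_pos[of "Suc (length w)"] by (auto simp: cyl_eq)
  then show ?thesis unfolding disjoint_family_on_def by (metis inf_commute linorder_neqE_nat)
qed

lemma mass_pieces: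
  assumes "w \<in> words n k" "S \<subseteq> {..<n (Suc k)}"
  shows "mass (\<Union>e\<in>S. cyl n c (w @ [Suc e])) = M w * (\<Sum>e\<in>S. P (Suc k) ! e)"
proof -
  have "mass (\<Union>e\<in>S. cyl n c (w @ [Suc e])) = (\<Sum>e\<in>S. M (w @ [Suc e]))"
    using assms(2) finite_subset pieces_disjoint by (intro mass_Union) auto
  also have "\<dots> = (\<Sum>e\<in>S. M w * P (Suc k) ! e)"
    using assms by (intro sum.cong) (auto simp: M_piece mult.commute)
  finally show ?thesis by (simp add: sum_distrib_left)
qed

lemma mass_piece_range:
  assumes "w \<in> words n k" "b \<le> n (Suc k)"
  shows "mass (\<Union>e\<in>{a..<b}. cyl n c (w @ [Suc e])) = M w * (\<Sum>e=a..<b. P (Suc k) ! e)"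
  using assms(2) by (intro mass_pieces[OF assms(1)]) auto

lemma ball_borel [simp]: "ball (x::real) r \<in> sets borel"
  by simp

text \<open>
Finiteness is automatic for a probability measure, and positivity holds because every ball
about a point of \<open>E\<close> contains a component.
\<close>

lemma doubling_iff:
  "doubling_on E \<mu> \<longleftrightarrow>
    (\<exists>C\<ge>1. \<forall>x\<in>E. \<forall>r>0. mass (ball x (2 * r)) \<le> C * mass (ball x r))"
proof -
  have pos: "0 < mass (ball x (2 * r))" if x: "x \<in> E" and r: "r > 0" for x r
  proof -
    obtain k where k: "len k < 2 * r"
      using order_tendstoD(2)[OF comp_len_tendsto_0[OF data], of "2 * r"] r
      by (auto simp: eventually_sequentially)
    obtain w where w: "w \<in> words n k" "x \<in> cyl n c w" using E_cyl[OF x] .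
    have "M w \<le> mass (ball x (2 * r))"
      using w k length_words[OF w(1)]
        by (intro mass_mono) (auto simp: cyl_eq hi_def dist_real_def)
    then show ?thesis using M_pos[OF w(1)] by linarith
  qed
  have "0 < emeasure \<mu> (ball x (2 * r) \<inter> E) \<and>
        emeasure \<mu> (ball x (2 * r) \<inter> E) \<le> ennreal C * emeasure \<mu> (ball x r \<inter> E) \<and>
        ennreal C * emeasure \<mu> (ball x r \<inter> E) < \<infinity> \<longleftrightarrow> mass (ball x (2 * r)) \<le> C * mass (ball x r)"
    if "x \<in> E" "r > 0" "C \<ge> 1" for x r C
    using pos[OF that(1,2)] that(3) by (simp add: emeasure_mass flip: ennreal_mult)
  then show ?thesis unfolding doubling_on_def using sets_mu by blast
qed

end

section \<open>Uniform vectors give a doubling measure\<close>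

context cantor_measure
begin

lemma C_uniform_ge1: "C_uniform C p \<Longrightarrow> C \<ge> 1"
  by (simp add: C_uniform_def Cs_uniform_def)

text \<open>
The ball catches all pieces of the component at distance at most \<open>h\<close> from the piece of its
centre, where \<open>h\<close> is about \<open>r\<close> divided by the spacing, hence a window of length \<open>min N (h + 1)\<close> if
there are \<open>N\<close> pieces. The larger window has fewer than \<open>2r\<close> divided by the spacing plus one
pieces, which is at most four times as many.
\<close>

lemma window_le_ball:
  assumes w: "w \<in> words n k" and i: "i < n (Suc k)" "x \<in> cyl n c (w @ [Suc i])"
    and r: "len (Suc k) < r" and C: "C_uniform C (P (Suc k))"
    and ab: "a \<le> i" "i < b" "b \<le> n (Suc k)" "(real b - real a - 1) * pitch (Suc k) < 2 * r"
  shows "M w * (\<Sum>t=a..<b. P (Suc k) ! t) \<le> 4 * C ^ 5 * mass (ball x r)"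
proof -
  define N where "N = n (Suc k)"
  define p where "p = pitch (Suc k)"
  have p: "p > 0" using pitch_pos[of "Suc k"] by (simp add: p_def)
  have lw: "length w = k" using w length_words by blast
  have "(r - len (Suc k)) / p > 0" using r p by simp
  then obtain h where h: "real h < (r - len (Suc k)) / p" "(r - len (Suc k)) / p \<le> real h + 1"
    by (rule ceiling_index)
  have h': "real h * p + len (Suc k) < r" "r \<le> (real h + 1) * p + len (Suc k)"
    using h p by (simp_all add: field_simps)
  \<comment> \<open>a window of \<open>l\<close> pieces inside the ball; it starts at \<open>i\<close> unless it would run out of the component\<close>
  define l where "l = min N (h + 1)"
  define j where "j = min i (N - l)"
  have l: "1 \<le> l" "l \<le> h + 1" "j + l \<le> N" "j \<le> i" "i < j + l"
    using i branches[of k] by (auto simp: l_def j_def N_def min_def)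
  have catch: "cyl n c (w @ [Suc e]) \<subseteq> ball x r" if "e \<in> {j..<j+l}" for e
  proof
    fix y assume y: "y \<in> cyl n c (w @ [Suc e])"
    have "\<bar>real e - real i\<bar> \<le> real h" using that l by auto
    then have "\<bar>real e - real i\<bar> * p \<le> real h * p" using p by (intro mult_right_mono) auto
    then have "\<bar>real e * p - real i * p\<bar> \<le> real h * p"
      using p by (simp add: abs_mult flip: left_diff_distrib)
    then show "y \<in> ball x r"
      using pos_in_piece[OF lw y] pos_in_piece[OF lw i(2)] h'(1) unfolding p_def[symmetric]
      by (simp add: dist_real_def)
  qed
  have "M w * win (P (Suc k)) j l = mass (\<Union>e\<in>{j..<j+l}. cyl n c (w @ [Suc e]))"
    using l by (simp add: win_def mass_piece_range[OF w] N_def)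
  also have "\<dots> \<le> mass (ball x r)"
    using catch by (intro mass_mono ball_borel) blast
  finally have 1: "M w * win (P (Suc k)) j l \<le> mass (ball x r)" .
  have "(real b - real a - 1) * p < (2 * (real h + 2)) * p"
    using ab(4) h'(2) len_le_pitch[of k] by (simp add: p_def algebra_simps)
  then have "real b - real a - 1 < 2 * (real h + 2)" using p mult_less_cancel_right_pos by blast
  then have "real b < real (a + (2 * h + 5))" by simp
  then have "b < a + (2 * h + 5)" by (simp only: of_nat_less_iff)
  then have "b - a \<le> 4 * (h + 1)" by arith
  then have ba: "b \<le> a + 4 * l" using ab(3) by (auto simp: l_def min_def N_def)
  \<comment> \<open>\<open>4 * l\<close> pieces, and \<open>{a..<b}\<close> and \<open>{j..<j + l}\<close> share \<open>i\<close>: starting points differ by at most \<open>5 * l\<close>\<close>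
  have "(\<Sum>t=a..<b. P (Suc k) ! t) \<le> real 4 * (C ^ 5 * win (P (Suc k)) j l)"
    using ab l ba by (intro sum_le_nearby_window[OF C]) (auto simp: length_P N_def)
  then have "M w * (\<Sum>t=a..<b. P (Suc k) ! t) \<le> M w * (4 * (C ^ 5 * win (P (Suc k)) j l))"
    by (intro mult_left_mono) auto
  also have "\<dots> = 4 * C ^ 5 * (M w * win (P (Suc k)) j l)" by simp
  also have "\<dots> \<le> 4 * C ^ 5 * mass (ball x r)"
    using 1 C_uniform_ge1[OF C] by (intro mult_left_mono) auto
  finally show ?thesis .
qed

text \<open>
The pieces of a component shorter than \<open>2r\<close> form a window to which the previous estimate
applies one level further down: these pieces are shorter than \<open>r\<close>.
\<close>

lemma component_le_ball:
  assumes w: "w \<in> words n k" "x \<in> E" "x \<in> cyl n c w" and r: "len k < 2 * r"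
    and C: "C_uniform C (P (Suc k))"
  shows "M w \<le> 4 * C ^ 5 * mass (ball x r)"
proof -
  obtain i where i: "i < n (Suc k)" "x \<in> cyl n c (w @ [Suc i])"
    using E_piece[OF w(2,1,3)] .
  have "M w * (\<Sum>t=0..<n (Suc k). P (Suc k) ! t) \<le> 4 * C ^ 5 * mass (ball x r)"
  proof (rule window_le_ball[OF w(1) i _ C])
    show "len (Suc k) < r" using comp_len_half[OF data, of k] r by linarith
    show "(real (n (Suc k)) - real 0 - 1) * pitch (Suc k) < 2 * r"
      using len_split[of k] r len_pos[of "Suc k"] by (simp add: pitch_def algebra_simps)
  qed (use i in auto)
  then show ?thesis using P_sum[of k] by (simp add: atLeast0LessThan)
qed

text \<open>
If \<open>r\<close> does not exceed the length of a piece, the ball may contain none, but then the window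
has at most two pieces. The piece that contains the centre is shorter than \<open>2r\<close> and is
compared with the ball by \<open>component_le_ball\<close>.
\<close>

lemma window_le_small_ball:
  assumes w: "w \<in> words n k" and i: "i < n (Suc k)" "x \<in> cyl n c (w @ [Suc i])" "x \<in> E"
    and r: "len (Suc k) < 2 * r" and C: "C_uniform C (P (Suc k))" "C_uniform C (P (Suc (Suc k)))"
    and ab: "a \<le> i" "i < b" "b \<le> n (Suc k)" "(real b - real a - 1) * pitch (Suc k) < 2 * r"
  shows "M w * (\<Sum>t=a..<b. P (Suc k) ! t) \<le> 8 * C ^ 6 * mass (ball x r)"
proof (cases "len (Suc k) < r")
  case True
  have "4 * C ^ 5 \<le> 8 * C ^ 6"
    using C_uniform_ge1[OF C(1)] power_increasing[of 5 6 C] zero_le_power[of C 6] by linarith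
  then have "4 * C ^ 5 * mass (ball x r) \<le> 8 * C ^ 6 * mass (ball x r)"
    by (intro mult_right_mono) auto
  then show ?thesis
    using window_le_ball[OF w i(1,2) True C(1) ab] by linarith
next
  case False
  have "(real b - real a - 1) * pitch (Suc k) < 2 * pitch (Suc k)"
    using ab(4) False len_le_pitch[of k] by linarith
  then have ba: "b \<le> a + 2" using pitch_pos[of "Suc k"] by (simp add: mult_less_cancel_right)
  have "(\<Sum>t=a..<b. P (Suc k) ! t) \<le> real 2 * (C ^ 1 * win (P (Suc k)) i 1)"
    using ab ba i by (intro sum_le_nearby_window[OF C(1)]) (auto simp: length_P)
  then have "M w * (\<Sum>t=a..<b. P (Suc k) ! t) \<le> M w * (2 * (C * P (Suc k) ! i))"
    by (intro mult_left_mono) auto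
  also have "\<dots> = 2 * C * M (w @ [Suc i])" using M_piece[OF w i(1)] by simp
  also have "M (w @ [Suc i]) \<le> 4 * C ^ 5 * mass (ball x r)"
    using w i r words_snoc_iff[of w "Suc i" n k]
      by (intro component_le_ball[OF _ i(3,2) r C(2)]) auto
  finally show ?thesis using C_uniform_ge1[OF C(1)] by (simp add: mult.assoc numeral_eq_Suc)
qed

lemma append_window_halves:
  assumes "q \<le> length p"
  shows "win (p @ p) (length p - q) q = win p (length p - q) q"
    "win (p @ p) (length p) q = win p 0 q"
proof -
  show "win (p @ p) (length p - q) q = win p (length p - q) q"
    using assms unfolding win_def by (intro sum.cong) (auto simp: nth_append)
  have "(\<Sum>t=0+length p..<q+length p. (p @ p) ! t) = (\<Sum>t=0..<q. (p @ p) ! (t + length p))"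
    by (rule sum.shift_bounds_nat_ivl)
  then show "win (p @ p) (length p) q = win p 0 q"
    by (simp add: win_def nth_append add.commute)
qed

text \<open>
At level \<open>k\<close> the two masses are adjacent entries of \<open>P\<^sub>k\<close> times a common factor. Each level below
multiplies them by the last and by the first entry of \<open>P\<^sub>k\<^sub>+\<^sub>t\<close>, which are adjacent in
\<open>(P\<^sub>k\<^sub>+\<^sub>t, P\<^sub>k\<^sub>+\<^sub>t)\<close>.
\<close>

lemma neighbours_mass_uniform:
  assumes "neighbours k t v v'" "C_uniform C (P k)" "t < m"
    "\<And>t. 1 \<le> t \<Longrightarrow> t < m \<Longrightarrow> C_uniform C (P (k + t) @ P (k + t))"
  shows "M v \<le> C ^ (t + 1) * M v' \<and> M v' \<le> C ^ (t + 1) * M v"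
  using assms(1,3)
proof (induction t arbitrary: v v')
  case 0
  from 0 obtain z i where z: "k \<ge> 1" "z\<in>words n (k - 1)" "Suc i < n k"
     "v = z @ [Suc i]" "v' = z @ [Suc (Suc i)]"
    unfolding neighbours_def by auto
  have k: "Suc (k - 1) = k" using z by simp
  have "P k ! i \<le> C * P k ! Suc i" "P k ! Suc i \<le> C * P k ! i"
    using Cs_uniformD[OF assms(2)[unfolded C_uniform_def], of 1 i "Suc i"]
     Cs_uniformD[OF assms(2)[unfolded C_uniform_def], of 1 "Suc i" i] z length_P'[of k] by auto
  then have "P k ! i * M z \<le> C * P k ! Suc i * M z" "P k ! Suc i * M z \<le> C * P k ! i * M z"
    by (auto intro!: mult_right_mono)
  then show ?case using M_piece[OF z(2), of i] M_piece[OF z(2), of "Suc i"] z k by simp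
next
  case (Suc t)
  obtain u u' where u: "v = u @ [n (Suc (k + t))]" "v' = u' @ [Suc 0]" "neighbours k t u u'"
    using neighbours_SucE[OF Suc.prems(1)] .
  define Q where "Q = P (Suc (k + t))"
  define N where "N = n (Suc (k + t))"
  have N: "N \<ge> 2" using branches by (simp add: N_def)
  have lQ: "length Q = N" by (simp add: Q_def N_def length_P)
  have C: "Cs_uniform C 1 (Q @ Q)" using assms(4)[of "Suc t"] Suc.prems
    by (simp add: Q_def C_uniform_def)
  have C1: "C \<ge> 1" using C by (simp add: Cs_uniform_def)
  have Mv: "M v = Q ! (N - 1) * M u" and Mv': "M v' = Q ! 0 * M u'"
    using M_piece[OF neighbours_props(2)[OF u(3)], of "N - 1"]
      M_piece[OF neighbours_props(3)[OF u(3)], of 0] N unfolding u by (simp_all add: N_def Q_def)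
  have Q: "Q ! (N - 1) \<le> C * Q ! 0" "Q ! 0 \<le> C * Q ! (N - 1)"
    using Cs_uniformD[OF C, of 1 "N - 1" N] Cs_uniformD[OF C, of 1 N "N - 1"] N lQ
    by (auto simp: nth_append)
  have Q0: "Q ! (N - 1) \<ge> 0" "Q ! 0 \<ge> 0"
    using P_pos[of "N - 1" "k + t"] P_pos[of 0 "k + t"] N by (auto simp: Q_def N_def)
  have IH: "M u \<le> C ^ (t + 1) * M u'" "M u' \<le> C ^ (t + 1) * M u"
    using Suc.IH[OF u(3)] Suc.prems by auto
  have "Q ! (N - 1) * M u \<le> (C * Q ! 0) * (C ^ (t + 1) * M u')"
    using Q IH Q0 C1 by (intro mult_mono) auto
  moreover have "Q ! 0 * M u' \<le> (C * Q ! (N - 1)) * (C ^ (t + 1) * M u)"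
    using Q IH Q0 C1 by (intro mult_mono) auto
  ultimately show ?case unfolding Mv Mv' by (simp add: mult_ac)
qed

context
  fixes C :: real and m :: nat
  assumes C: "C_uniform_seq C P"
    and appended: "\<forall>k\<in>Lambda n c.
        (\<forall>t. 1 \<le> t \<and> t < m_idx n c k \<longrightarrow> C_uniform C (P (k + t) @ P (k + t))) \<and>
        Cs_uniform C (s_idx n c k) (P (k + m_idx n c k) @ P (k + m_idx n c k))"
    and m_bound: "\<And>k. k \<in> Lambda n c \<Longrightarrow> m_idx n c k \<le> m"
begin

text \<open>
The heart of this direction: blocks of \<open>q\<close> pieces on the two sides of a gap that a ball of
radius \<open>2r\<close> can cross have comparable masses. That the gap is crossed bounds the level from
above, and at the last admissible level \<open>k + m\<^sub>k\<close> it makes \<open>q\<close> at least \<open>s\<^sub>k\<close>.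
\<close>

lemma edge_windows:
  assumes nb: "neighbours k t v v'"
    and j: "j = Suc (k + t)"
    and r: "gap k < 2 * r" "2 * r \<le> len (k + t)"
    and q: "2 * r \<le> real q * pitch j" "1 \<le> q" "q \<le> n j"
  shows "M v' * win (P j) 0 q \<le> C ^ (m + 1) * (M v * win (P j) (n j - q) q)"
    "M v * win (P j) (n j - q) q \<le> C ^ (m + 1) * (M v' * win (P j) 0 q)"
proof -
  have k: "k \<ge> 1" using neighbours_props(1)[OF nb] .
  have C1: "C \<ge> 1" using C k C_uniform_ge1 by (auto simp: C_uniform_seq_def)
  have kL: "k \<in> Lambda n c" using k r len_mono[of k "k + t"] by (simp add: Lambda_def)
  note mk = m_idx_props[OF kL]
  have "len (k + m_idx n c k) < len (k + t)" using mk r by linarith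
  then have tm: "t < m_idx n c k" by (simp add: len_less_iff)
  have lP: "length (P j) = n j" by (simp add: j length_P)
  \<comment> \<open>the only place where the two parts of (b) are told apart\<close>
  have uniform: "\<exists>s\<le>q. Cs_uniform C s (P j @ P j)"
  proof (cases "Suc t < m_idx n c k")
    case True
    then show ?thesis using appended[rule_format, OF kL] q j
      by (intro exI[of _ 1]) (auto simp: C_uniform_def dest: spec[of _ "Suc t"])
  next
    case False
    then have jm: "j = k + m_idx n c k" using tm j by simp
    have "(real (s_idx n c k) - 1) * pitch j < real q * pitch j"
      using s_idx_props(2)[OF kL, folded jm] r q len_pos[of j] by linarith
    then have "s_idx n c k \<le> q" using pitch_pos[of j] j by (simp add: mult_less_cancel_right)
    then show ?thesis using appended kL jm by (intro exI[of _ "s_idx n c k"]) auto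
  qed
  then obtain s where s: "s \<le> q" "Cs_uniform C s (P j @ P j)" by blast
  have w: "win (P j) 0 q \<le> C * win (P j) (n j - q) q" "win (P j) (n j - q) q \<le> C * win (P j) 0 q"
    using Cs_uniformD[OF s(2,1), of "n j - q" "n j"] Cs_uniformD[OF s(2,1), of "n j" "n j - q"] q
      append_window_halves[of q "P j"] lP by auto
  have M: "M v \<le> C ^ (t + 1) * M v' \<and> M v' \<le> C ^ (t + 1) * M v"
    using appended kL C k by (intro neighbours_mass_uniform[OF nb _ tm]) (auto simp: C_uniform_seq_def)
  have w0: "win (P j) 0 q \<ge> 0" "win (P j) (n j - q) q \<ge> 0"
    using P_vector(1)[of "k + t"] q lP by (auto simp: j intro!: win_nonneg)
  have le: "C ^ (t + 1) * C \<le> C ^ (m + 1)"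
    using power_increasing[of "t + 2" "m + 1" C] C1 tm m_bound[OF kL] by (simp add: mult_ac)
  have "M v' * win (P j) 0 q \<le> (C ^ (t + 1) * M v) * (C * win (P j) (n j - q) q)"
    using M w w0 C1 by (intro mult_mono) auto
  also have "\<dots> = (C ^ (t + 1) * C) * (M v * win (P j) (n j - q) q)" by simp
  also have "\<dots> \<le> C ^ (m + 1) * (M v * win (P j) (n j - q) q)"
    using le w0 by (intro mult_right_mono) auto
  finally show "M v' * win (P j) 0 q \<le> C ^ (m + 1) * (M v * win (P j) (n j - q) q)" .
  have "M v * win (P j) (n j - q) q \<le> (C ^ (t + 1) * M v') * (C * win (P j) 0 q)"
    using M w w0 C1 by (intro mult_mono) auto
  also have "\<dots> = (C ^ (t + 1) * C) * (M v' * win (P j) 0 q)" by simp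
  also have "\<dots> \<le> C ^ (m + 1) * (M v' * win (P j) 0 q)"
    using le w0 by (intro mult_right_mono) auto
  finally show "M v * win (P j) (n j - q) q \<le> C ^ (m + 1) * (M v' * win (P j) 0 q)" .
qed

lemma uniform_P: "C_uniform C (P (Suc k))"
  using C by (simp add: C_uniform_seq_def)

text \<open>
In the neighbour the ball meets at most the first \<open>q\<close> pieces, by the choice of \<open>q\<close>. For the same
reason \<open>x\<close> lies in one of the last \<open>q\<close> pieces of its own component, so that the block opposite
can be compared with \<open>B(x, r)\<close>.
\<close>

lemma right_neighbour_le_ball:
  assumes nb: "neighbours k t v v'" and j: "j = Suc (k + t)"
    and r: "len j < 2 * r" "2 * r \<le> len (k + t)"
    and q: "2 * r \<le> real q * pitch j" "(real q - 1) * pitch j < 2 * r" "1 \<le> q" "q \<le> n j"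
    and x: "x \<in> E" "x \<in> cyl n c (v @ [Suc i])" "i < n j"
    and y: "y \<in> cyl n c v'" "y - x < 2 * r"
  shows "mass (ball x (2 * r) \<inter> cyl n c v') \<le> C ^ (m + 1) * (8 * C ^ 6 * mass (ball x r))"
proof -
  note np = neighbours_props[OF nb]
  have lv: "length v = k + t" "length v' = k + t" using np length_words by auto
  have C1: "C \<ge> 1" using C_uniform_ge1[OF uniform_P[of 0]] .
  have x': "x \<le> hi v" using x cyl_piece_subset[of i v] lv j by (auto simp: cyl_eq)
  have g: "gap k < 2 * r" using np(4) y x' by (auto simp: cyl_eq)
  have "mass (ball x (2 * r) \<inter> cyl n c v') \<le> mass (\<Union>e\<in>{0..<q}. cyl n c (v' @ [Suc e]))"
  proof (rule mass_mono)
    fix z assume z: "z \<in> E" "z \<in> ball x (2 * r) \<inter> cyl n c v'"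
    obtain e where e: "e < n (Suc (k + t))" "z \<in> cyl n c (v' @ [Suc e])"
      using E_piece[OF z(1) np(3)] z by blast
    have "real e * pitch j < real q * pitch j"
      using pos_in_piece(1)[OF lv(2) e(2)] z(2) x' np(4) gap_pos[OF np(1)] q(1) j
      by (auto simp: dist_real_def)
    then have "e < q" using pitch_pos[of j] j by (simp add: mult_less_cancel_right)
    then show "z \<in> (\<Union>e\<in>{0..<q}. cyl n c (v' @ [Suc e]))" using e by auto
  qed auto
  also have "\<dots> = M v' * win (P j) 0 q"
    using q j by (simp add: mass_piece_range[OF np(3)] win_def)
  also have "\<dots> \<le> C ^ (m + 1) * (M v * win (P j) (n j - q) q)"
    by (rule edge_windows(1)[OF nb j g r(2) q(1,3,4)])
  also have "M v * win (P j) (n j - q) q = M v * (\<Sum>t=n j - q..<n j. P j ! t)"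
    using q by (simp add: win_def)
  also have "\<dots> \<le> 8 * C ^ 6 * mass (ball x r)"
    unfolding j
  proof (rule window_le_small_ball[OF np(2) _ _ x(1) _ uniform_P uniform_P])
    have "hi v = lo v + real (n j - 1) * pitch j + len j"
      using len_split[of "k + t"] branches[of "k + t"] lv j
        by (simp add: hi_def pitch_def of_nat_diff algebra_simps)
    then have "real (n j - 1) * pitch j - real i * pitch j < real q * pitch j"
      using pos_in_piece(2)[OF lv(1) x(2)] y np(4) gap_pos[OF np(1)] q(1) j by (auto simp: cyl_eq)
    then have "(real (n j - 1) - real i) * pitch j < real q * pitch j"
      by (simp add: algebra_simps)
    then have "real (n j - 1) - real i < real q" using pitch_pos[of j] j
      by (simp add: mult_less_cancel_right)
    then have "real (n j - 1) < real (i + q)" by simp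
    then have "n j - 1 < i + q" by (simp only: of_nat_less_iff)
    then show "n (Suc (k + t)) - q \<le> i" using j by simp
  qed (use x r q j in \<open>auto simp: of_nat_diff\<close>)
  finally show ?thesis using C1 by (auto intro!: mult_left_mono)
qed

text \<open>
The mirror image of \<open>right_neighbour_le_ball\<close>.
\<close>

lemma left_neighbour_le_ball:
  assumes nb: "neighbours k t v v'" and j: "j = Suc (k + t)"
    and r: "len j < 2 * r" "2 * r \<le> len (k + t)"
    and q: "2 * r \<le> real q * pitch j" "(real q - 1) * pitch j < 2 * r" "1 \<le> q" "q \<le> n j"
    and x: "x \<in> E" "x \<in> cyl n c (v' @ [Suc i])" "i < n j"
    and y: "y \<in> cyl n c v" "x - y < 2 * r"
  shows "mass (ball x (2 * r) \<inter> cyl n c v) \<le> C ^ (m + 1) * (8 * C ^ 6 * mass (ball x r))"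
proof -
  note np = neighbours_props[OF nb]
  have lv: "length v = k + t" "length v' = k + t" using np length_words by auto
  have C1: "C \<ge> 1" using C_uniform_ge1[OF uniform_P[of 0]] .
  have x': "lo v' \<le> x" using x cyl_piece_subset[of i v'] lv j by (auto simp: cyl_eq)
  have g: "gap k < 2 * r" using np(4) y x' by (auto simp: cyl_eq)
  have hv: "hi v = lo v + real (n j - 1) * pitch j + len j"
    using len_split[of "k + t"] branches[of "k + t"] lv j
      by (simp add: hi_def pitch_def of_nat_diff algebra_simps)
  have "mass (ball x (2 * r) \<inter> cyl n c v) \<le> mass (\<Union>e\<in>{n j - q..<n j}. cyl n c (v @ [Suc e]))"
  proof (rule mass_mono)
    fix z assume z: "z \<in> E" "z \<in> ball x (2 * r) \<inter> cyl n c v"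
    obtain e where e: "e < n (Suc (k + t))" "z \<in> cyl n c (v @ [Suc e])"
      using E_piece[OF z(1) np(2)] z by blast
    have "real (n j - 1) * pitch j - real e * pitch j < real q * pitch j"
      using pos_in_piece(2)[OF lv(1) e(2)] z(2) x' np(4) gap_pos[OF np(1)] q(1) j hv
      by (auto simp: dist_real_def)
    then have "(real (n j - 1) - real e) * pitch j < real q * pitch j"
      by (simp add: algebra_simps)
    then have "real (n j - 1) - real e < real q" using pitch_pos[of j] j
      by (simp add: mult_less_cancel_right)
    then have "real (n j - 1) < real (e + q)" by simp
    then have "n j - 1 < e + q" by (simp only: of_nat_less_iff)
    then have "n j - q \<le> e" by simp
    then show "z \<in> (\<Union>e\<in>{n j - q..<n j}. cyl n c (v @ [Suc e]))" using e j by auto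
  qed auto
  also have "\<dots> = M v * win (P j) (n j - q) q"
    using q j by (simp add: mass_piece_range[OF np(2)] win_def)
  also have "\<dots> \<le> C ^ (m + 1) * (M v' * win (P j) 0 q)"
    by (rule edge_windows(2)[OF nb j g r(2) q(1,3,4)])
  also have "M v' * win (P j) 0 q = M v' * (\<Sum>t=0..<q. P j ! t)"
    by (simp add: win_def)
  also have "\<dots> \<le> 8 * C ^ 6 * mass (ball x r)"
    unfolding j
  proof (rule window_le_small_ball[OF np(3) _ _ x(1) _ uniform_P uniform_P])
    have "real i * pitch j < real q * pitch j"
      using pos_in_piece(1)[OF lv(2) x(2)] y np(4) gap_pos[OF np(1)] q(1) j by (auto simp: cyl_eq)
    then show "i < q" using pitch_pos[of j] j by (simp add: mult_less_cancel_right)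
  qed (use x r q j in auto)
  finally show ?thesis using C1 by (auto intro!: mult_left_mono)
qed

text \<open>
The ball meets at most \<open>2q + 1 \<le> 3q\<close> pieces of the component of its centre; three windows of
length \<open>q\<close> near the centre cover them.
\<close>

lemma own_component_le_ball:
  assumes w: "w \<in> words n k" and j: "j = Suc k"
    and r: "len j < 2 * r"
    and q: "2 * r \<le> real q * pitch j" "(real q - 1) * pitch j < 2 * r" "1 \<le> q" "q \<le> n j"
    and x: "x \<in> E" "x \<in> cyl n c (w @ [Suc i])" "i < n j"
  shows "mass (ball x (2 * r) \<inter> cyl n c w) \<le> 3 * C ^ 2 * (8 * C ^ 6 * mass (ball x r))"
proof -
  have lw: "length w = k" using w length_words by auto
  have C1: "C \<ge> 1" using C_uniform_ge1[OF uniform_P[of 0]] .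
  define a b where "a = i - q" and "b = min (n j) (i + q + 1)"
  define s where "s = min i (n j - q)"
  have s: "s \<le> i" "i < s + q" "s + q \<le> n j" using q x by (auto simp: s_def min_def)
  have "mass (ball x (2 * r) \<inter> cyl n c w) \<le> mass (\<Union>e\<in>{a..<b}. cyl n c (w @ [Suc e]))"
  proof (rule mass_mono)
    fix z assume z: "z \<in> E" "z \<in> ball x (2 * r) \<inter> cyl n c w"
    obtain e where e: "e < n (Suc k)" "z \<in> cyl n c (w @ [Suc e])"
      using E_piece[OF z(1) w] z by blast
    have "\<bar>real e * pitch j - real i * pitch j\<bar> < real q * pitch j + pitch j"
      using pos_in_piece[OF lw e(2)] pos_in_piece[OF lw x(2)] z(2) q(1) j len_le_pitch[of k]
      by (auto simp: dist_real_def)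
    then have "\<bar>real e - real i\<bar> * pitch j < (real q + 1) * pitch j"
      using pitch_pos[of j] j by (simp add: distrib_right abs_mult flip: left_diff_distrib)
    then have "\<bar>real e - real i\<bar> < real q + 1" using pitch_pos[of j] j
      by (simp add: mult_less_cancel_right)
    then have "real e < real (i + q + 1)" "real i < real (e + q + 1)" by simp_all
    then have "e < i + q + 1" "i < e + q + 1" by (simp_all only: of_nat_less_iff)
    then have "a \<le> e" "e < b" using e j unfolding a_def b_def by auto
    then show "z \<in> (\<Union>e\<in>{a..<b}. cyl n c (w @ [Suc e]))" using e j by auto
  qed auto
  also have "\<dots> = M w * (\<Sum>t=a..<b. P j ! t)"
    using q j by (simp add: mass_piece_range[OF w] b_def)
  also have "\<dots> \<le> M w * (real 3 * (C ^ 2 * win (P j) s q))"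
    unfolding j using q s x j
    by (intro mult_left_mono sum_le_nearby_window[OF uniform_P]) (auto simp: length_P a_def b_def)
  also have "M w * (real 3 * (C ^ 2 * win (P j) s q)) = 3 * C ^ 2 * (M w * (\<Sum>t=s..<s+q. P j ! t))"
    by (simp add: win_def)
  also have "M w * (\<Sum>t=s..<s+q. P j ! t) \<le> 8 * C ^ 6 * mass (ball x r)"
    unfolding j using x r q j s
      by (intro window_le_small_ball[OF w _ _ x(1) _ uniform_P uniform_P]) auto
  finally show ?thesis using C1 by (auto intro!: mult_left_mono)
qed

text \<open>
What the ball meets on the right of the component of its centre lies in the unique right
neighbour, and similarly on the left, because \<open>2r\<close> is at most the length of a component.
\<close>

lemma ball_in_three_components:
  assumes w: "w \<in> words n k" and j: "j = Suc k"
    and r: "len j < 2 * r" "2 * r \<le> len k"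
    and q: "2 * r \<le> real q * pitch j" "(real q - 1) * pitch j < 2 * r" "1 \<le> q" "q \<le> n j"
    and x: "x \<in> E" "x \<in> cyl n c (w @ [Suc i])" "i < n j"
  shows "mass (ball x (2 * r)) \<le> (3 * C ^ 2 + 2 * C ^ (m + 1)) * (8 * C ^ 6 * mass (ball x r))"
proof -
  define B where "B = ball x (2 * r)"
  define m0 where "m0 = 8 * C ^ 6 * mass (ball x r)"
  have C1: "C \<ge> 1" using C_uniform_ge1[OF uniform_P[of 0]] .
  have m0: "C ^ (m + 1) * m0 \<ge> 0" using C1 by (simp add: m0_def)
  have lw: "length w = k" using w length_words by auto
  have xw: "x \<in> cyl n c w" using x cyl_piece_subset[of i w] lw j by auto
  have B: "B \<in> sets borel" by (simp add: B_def)
  have near: "\<exists>k' t. neighbours k' t w w' \<and> k = k' + t"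
    if "w' \<in> words n k" "w' \<noteq> w" "y \<in> cyl n c w'" "y \<in> B" "x < y" for y w'
    using that r j by (intro close_points_neighbours[OF w that(1) _ xw that(3)]) (auto simp: B_def dist_real_def)
  have near': "\<exists>k' t. neighbours k' t w' w \<and> k = k' + t"
    if "w' \<in> words n k" "w' \<noteq> w" "y \<in> cyl n c w'" "y \<in> B" "y < x" for y w'
    using that r j by (intro close_points_neighbours[OF that(1) w _ that(3) xw]) (auto simp: B_def dist_real_def)
  define R where "R = {y \<in> B. hi w < y}"
  define L where "L = {y \<in> B. y < lo w}"
  have RL: "R \<in> sets borel" "L \<in> sets borel"
  proof -
    have "R = B \<inter> {hi w<..}" "L = B \<inter> {..<lo w}" by (auto simp: R_def L_def)
    then show "R \<in> sets borel" "L \<in> sets borel" using B by auto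
  qed
  have xb: "lo w \<le> x" "x \<le> hi w" using xw by (auto simp: cyl_eq)
  have 1: "mass (B \<inter> cyl n c w) \<le> 3 * C ^ 2 * m0"
    unfolding B_def m0_def by (rule own_component_le_ball[OF w j r(1) q x])
  have 2: "mass R \<le> C ^ (m + 1) * m0"
  proof (cases "R \<inter> E = {}")
    case True
    then show ?thesis using m0 by (simp add: mass_def)
  next
    case False
    then obtain y where y: "y \<in> E" "y \<in> B" "hi w < y" by (auto simp: R_def)
    obtain w' where w': "w' \<in> words n k" "y \<in> cyl n c w'" using E_cyl[OF y(1)] .
    have ne: "w' \<noteq> w" using w' y by (auto simp: cyl_eq)
    obtain k' t where nb: "neighbours k' t w w'" "k = k' + t"
      using near[OF w'(1) ne w'(2) y(2)] y xb by auto
    have "mass R \<le> mass (B \<inter> cyl n c w')"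
    proof (rule mass_mono)
      fix z assume z: "z \<in> E" "z \<in> R"
      obtain w'' where w'': "w'' \<in> words n k" "z \<in> cyl n c w''" using E_cyl[OF z(1)] .
      have ne: "w'' \<noteq> w" using w'' z by (auto simp: cyl_eq R_def)
      obtain k'' t' where nb': "neighbours k'' t' w w''" "k = k'' + t'"
        using near[OF w''(1) ne w''(2)] z xb by (auto simp: R_def)
      have "w' = w''" using right_neighbour_unique[OF nb(1) nb'(1)] nb nb' by simp
      then show "z \<in> B \<inter> cyl n c w'" using z w'' by (auto simp: R_def)
    qed (use B in auto)
    also have "\<dots> \<le> C ^ (m + 1) * m0"
      unfolding B_def m0_def using r q x j nb(2) w' y
      by (intro right_neighbour_le_ball[OF nb(1), where j = j and q = q and i = i and y = y])
        (auto simp: B_def dist_real_def)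
    finally show ?thesis .
  qed
  have 3: "mass L \<le> C ^ (m + 1) * m0"
  proof (cases "L \<inter> E = {}")
    case True
    then show ?thesis using m0 by (simp add: mass_def)
  next
    case False
    then obtain y where y: "y \<in> E" "y \<in> B" "y < lo w" by (auto simp: L_def)
    obtain w' where w': "w' \<in> words n k" "y \<in> cyl n c w'" using E_cyl[OF y(1)] .
    have ne: "w' \<noteq> w" using w' y by (auto simp: cyl_eq)
    obtain k' t where nb: "neighbours k' t w' w" "k = k' + t"
      using near'[OF w'(1) ne w'(2) y(2)] y xb by auto
    have "mass L \<le> mass (B \<inter> cyl n c w')"
    proof (rule mass_mono)
      fix z assume z: "z \<in> E" "z \<in> L"
      obtain w'' where w'': "w'' \<in> words n k" "z \<in> cyl n c w''" using E_cyl[OF z(1)] .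
      have ne: "w'' \<noteq> w" using w'' z by (auto simp: cyl_eq L_def)
      obtain k'' t' where nb': "neighbours k'' t' w'' w" "k = k'' + t'"
        using near'[OF w''(1) ne w''(2)] z xb by (auto simp: L_def)
      have "w' = w''" using left_neighbour_unique[OF nb(1) nb'(1)] nb nb' by simp
      then show "z \<in> B \<inter> cyl n c w'" using z w'' by (auto simp: L_def)
    qed (use B in auto)
    also have "\<dots> \<le> C ^ (m + 1) * m0"
      unfolding B_def m0_def using r q x j nb(2) w' y
      by (intro left_neighbour_le_ball[OF nb(1), where j = j and q = q and i = i and y = y])
        (auto simp: B_def dist_real_def)
    finally show ?thesis .
  qed
  have "mass B \<le> mass ((B \<inter> cyl n c w) \<union> (R \<union> L))"
    using B RL by (intro mass_mono) (auto simp: R_def L_def cyl_eq)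
  also have "\<dots> \<le> mass (B \<inter> cyl n c w) + mass (R \<union> L)"
    using B RL by (intro mass_subadd) auto
  also have "mass (R \<union> L) \<le> mass R + mass L"
    using RL by (rule mass_subadd)
  finally have "mass B \<le> 3 * C ^ 2 * m0 + (C ^ (m + 1) * m0 + C ^ (m + 1) * m0)"
    using 1 2 3 by linarith
  then show ?thesis unfolding m0_def B_def by (simp add: algebra_simps)
qed

text \<open>
Every radius \<open>r \<le> 1/2\<close> falls between two consecutive component lengths in the sense required
by \<open>ball_in_three_components\<close>. For larger radii all of \<open>E\<close> has to be compared with the ball.
\<close>

lemma doubling_if_uniform:
  "\<exists>K\<ge>1. \<forall>x\<in>E. \<forall>r>0. mass (ball x (2 * r)) \<le> K * mass (ball x r)"
proof -
  \<comment> \<open>three windows in the component of the centre, one in each neighbour, each against \<open>B(x, r)\<close>\<close>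
  define K where "K = (3 * C ^ 2 + 2 * C ^ (m + 1)) * (8 * C ^ 6)"
  have C1: "C \<ge> 1" using C_uniform_ge1[OF uniform_P[of 0]] .
  have K1: "K \<ge> 4 * C ^ 5"
  proof -
    have "C ^ 6 \<ge> C ^ 5" "C ^ 2 \<ge> 1" "C ^ (m + 1) \<ge> 1" "C ^ 5 \<ge> 1"
      using C1 by (auto intro: power_increasing one_le_power simp del: power_Suc)
    then have "1 * (4 * C ^ 5) \<le> (3 * C ^ 2 + 2 * C ^ (m + 1)) * (8 * C ^ 6)"
      by (intro mult_mono) linarith+
    then show ?thesis by (simp add: K_def)
  qed
  have K2: "K \<ge> 1" using K1 one_le_power[OF C1, of 5] by linarith
  have "mass (ball x (2 * r)) \<le> K * mass (ball x r)" if x: "x \<in> E" and r: "r > 0" for x r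
  proof (cases "2 * r \<le> 1")
    case False
    have "mass (ball x (2 * r)) \<le> M []"
      using E_bounds by (intro mass_mono) (auto simp: cyl_Nil)
    also have "\<dots> \<le> 4 * C ^ 5 * mass (ball x r)"
      using False x E_bounds[OF x] uniform_P[of 0]
      by (intro component_le_ball[of _ 0]) (auto simp: words_def cyl_Nil)
    also have "\<dots> \<le> K * mass (ball x r)" using K1 by (intro mult_right_mono) auto
    finally show ?thesis .
  next
    case True
    \<comment> \<open>the level with \<open>len (Suc k) < 2 * r \<le> len k\<close>\<close>
    define k where "k = (LEAST k. len (Suc k) < 2 * r)"
    have "\<exists>k. len (Suc k) < 2 * r"
    proof -
      obtain k where "len k < 2 * r"
        using order_tendstoD(2)[OF comp_len_tendsto_0[OF data], of "2 * r"] r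
        by (auto simp: eventually_sequentially)
      then show ?thesis using len_mono[of k "Suc k"] by (intro exI[of _ k]) linarith
    qed
    then have k1: "len (Suc k) < 2 * r" unfolding k_def by (rule LeastI_ex)
    have k2: "2 * r \<le> len k"
    proof (cases k)
      case 0
      then show ?thesis using True by simp
    next
      case (Suc k')
      then have "\<not> len (Suc k') < 2 * r" unfolding k_def by (intro not_less_Least) simp
      then show ?thesis using Suc by simp
    qed
    define p where "p = pitch (Suc k)"
    have p: "p > 0" using pitch_pos[of "Suc k"] by (simp add: p_def)
    have "2 * r / p > 0" using r p by simp
    then obtain q' where q': "real q' < 2 * r / p" "2 * r / p \<le> real q' + 1"
      by (rule ceiling_index)
    have q: "2 * r \<le> real (Suc q') * p" "(real (Suc q') - 1) * p < 2 * r"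
      using q' p by (simp_all add: field_simps)
    have "real q' * p < real (n (Suc k)) * p"
      using q(2) k2 len_split[of k] gap_pos[of "Suc k"] by (simp add: p_def)
    then have qn: "Suc q' \<le> n (Suc k)" using p by (simp add: mult_less_cancel_right)
    obtain w where w: "w \<in> words n k" "x \<in> cyl n c w" using E_cyl[OF x] .
    obtain i where i: "i < n (Suc k)" "x \<in> cyl n c (w @ [Suc i])" using E_piece[OF x w] .
    show ?thesis
      using ball_in_three_components[OF w(1) refl k1 k2 q[unfolded p_def] _ qn x i(2,1)]
        by (simp add: K_def mult.assoc)
  qed
  then show ?thesis using K2 by blast
qed

end

end

section \<open>Comparing neighbouring components under a doubling measure\<close>

context cantor_measure
begin

context
  fixes D :: real
  assumes D: "D \<ge> 1" and doubling: "\<And>x r. x \<in> E \<Longrightarrow> r > 0 \<Longrightarrow> mass (ball x (2 * r)) \<le> D * mass (ball x r)"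
begin

text \<open>
The only way in which the doubling property is used from here on: a ball inside \<open>A\<close> that grows
over \<open>S\<close> after \<open>q\<close> doublings.
\<close>

lemma mass_compare:
  assumes "x \<in> E" "r > 0" "A \<in> sets borel"
    and A: "\<And>y. y \<in> E \<Longrightarrow> x - r < y \<Longrightarrow> y < x + r \<Longrightarrow> y \<in> A"
    and S: "\<And>y. y \<in> E \<Longrightarrow> y \<in> S \<Longrightarrow> x - 2 ^ q * r < y \<and> y < x + 2 ^ q * r"
  shows "mass S \<le> D ^ q * mass A"
proof -
  have *: "mass (ball x (2 ^ q * r)) \<le> D ^ q * mass (ball x r)"
  proof (induction q)
    case (Suc q)
    have "mass (ball x (2 ^ Suc q * r)) \<le> D * mass (ball x (2 ^ q * r))"
      using doubling[OF assms(1), of "2 ^ q * r"] assms(2) by (simp add: mult_ac)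
    also have "\<dots> \<le> D * (D ^ q * mass (ball x r))" using Suc D by (intro mult_left_mono) auto
    finally show ?case by simp
  qed simp
  have "mass S \<le> mass (ball x (2 ^ q * r))"
    using S by (intro mass_mono) (force simp: dist_real_def abs_less_iff)+
  also note *
  also have "D ^ q * mass (ball x r) \<le> D ^ q * mass A"
    using A D assms(3) by (intro mult_left_mono mass_mono) (auto simp: dist_real_def abs_less_iff)
  finally show ?thesis .
qed

text \<open>
A gap of level \<open>k\<close> at least as long as the components of level \<open>k\<close> isolates a component from its
siblings by a ball of radius \<open>\<epsilon>\<^sub>k\<close>. This ball must not reach beyond the parent. The parent may
be chosen freely, since the vector is the same in all of them: for the comparison with a
sibling on the right it is the leftmost one, with nothing of \<open>E\<close> on its left, and
symmetrically.
\<close>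

lemma entries_across_large_gap:
  assumes nL: "Suc k \<notin> Lambda n c" and e: "Suc e < n (Suc k)"
  shows "P (Suc k) ! e \<le> D ^ 2 * P (Suc k) ! Suc e" "P (Suc k) ! Suc e \<le> D ^ 2 * P (Suc k) ! e"
proof -
  define g where "g = gap (Suc k)"
  have g: "g > 0" "len (Suc k) \<le> g" using nL gap_pos by (auto simp: g_def Lambda_def)
  have isolated: "y \<in> cyl n c (w @ [Suc f])"
    if a: "w \<in> words n k" "f < n (Suc k)" "y \<in> E" "y \<in> cyl n c w" "lo (w @ [Suc f]) - g < y"
      "y < hi (w @ [Suc f]) + g" for w f y
  proof -
    have lw: "length w = k" using a length_words by blast
    obtain f' where f': "f' < n (Suc k)" "y \<in> cyl n c (w @ [Suc f'])" using E_piece[OF a(3,1,4)] .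
    have "\<not> f' < f" "\<not> f < f'"
      using hi_piece_less[of f' f w] hi_piece_less[of f f' w] f' a lw unfolding g_def
        by (auto simp: cyl_eq)
    then show ?thesis using f' by simp
  qed
  have sep: "lo (w @ [Suc (Suc e)]) = hi (w @ [Suc e]) + g"
    "hi (w @ [Suc f]) = lo (w @ [Suc f]) + len (Suc k)"
    if "length w = k" for w f
    using that by (simp_all add: hi_piece lo_piece g_def pitch_def algebra_simps)
  \<comment> \<open>in the leftmost component of level \<open>k\<close>, against the sibling on the right\<close>
  { define w where "w = replicate k (1::nat)"
    have w: "w \<in> words n k" "lo w = 0" using leftmost_word lo_leftmost by (auto simp: w_def)
    have lw: "length w = k" by (simp add: w_def)
    have "M (w @ [Suc (Suc e)]) \<le> D ^ 2 * M (w @ [Suc e])"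
    proof (rule mass_compare[where x = "hi (w @ [Suc e])" and r = g])
      show "hi (w @ [Suc e]) \<in> E" using w e
        by (intro hi_in_E[of _ "Suc k"]) (simp add: words_snoc_iff)
      fix y assume y: "y \<in> E" "hi (w @ [Suc e]) - g < y" "y < hi (w @ [Suc e]) + g"
      have "y \<le> hi w" using y(3) sep[OF lw] piece_within(2)[of "Suc e" w] e lw lo_le_hi[of "w @ [Suc (Suc e)]"] by simp
      then show "y \<in> cyl n c (w @ [Suc e])"
        using y w E_bounds[OF y(1)] e lo_le_hi[of "w @ [Suc e]"]
          by (intro isolated) (auto simp: cyl_eq)
    next
      fix y assume y: "y \<in> cyl n c (w @ [Suc (Suc e)])"
      show "hi (w @ [Suc e]) - 2 ^ 2 * g < y \<and> y < hi (w @ [Suc e]) + 2 ^ 2 * g"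
        using y sep[OF lw] g by (auto simp: cyl_eq)
    qed (use g in auto)
    then have "P (Suc k) ! Suc e * M w \<le> (D ^ 2 * P (Suc k) ! e) * M w"
      using M_piece[OF w(1)] e by simp
    then show "P (Suc k) ! Suc e \<le> D ^ 2 * P (Suc k) ! e" using M_pos[OF w(1)] by simp }
  \<comment> \<open>in the rightmost component of level \<open>k\<close>, against the sibling on the left\<close>
  { define w where "w = last_ext 0 k"
    have w: "w \<in> words n k" "hi w = 1" using rightmost_word hi_rightmost by (auto simp: w_def)
    have lw: "length w = k" by (simp add: w_def)
    have "M (w @ [Suc e]) \<le> D ^ 2 * M (w @ [Suc (Suc e)])"
    proof (rule mass_compare[where x = "lo (w @ [Suc (Suc e)])" and r = g])
      show "lo (w @ [Suc (Suc e)]) \<in> E" using w e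
        by (intro lo_in_E[of _ "Suc k"]) (simp add: words_snoc_iff)
      fix y assume y: "y \<in> E" "lo (w @ [Suc (Suc e)]) - g < y" "y < lo (w @ [Suc (Suc e)]) + g"
      have "lo w \<le> y" using y(2) sep[OF lw] piece_within(1)[of e w] e lw lo_le_hi[of "w @ [Suc e]"] by simp
      then show "y \<in> cyl n c (w @ [Suc (Suc e)])"
        using y w E_bounds[OF y(1)] e lo_le_hi[of "w @ [Suc (Suc e)]"]
          by (intro isolated) (auto simp: cyl_eq)
    next
      fix y assume y: "y \<in> cyl n c (w @ [Suc e])"
      show "lo (w @ [Suc (Suc e)]) - 2 ^ 2 * g < y \<and> y < lo (w @ [Suc (Suc e)]) + 2 ^ 2 * g"
        using y sep[OF lw] g by (auto simp: cyl_eq)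
    qed (use g in auto)
    then have "P (Suc k) ! e * M w \<le> (D ^ 2 * P (Suc k) ! Suc e) * M w"
      using M_piece[OF w(1)] e by simp
    then show "P (Suc k) ! e \<le> D ^ 2 * P (Suc k) ! Suc e" using M_pos[OF w(1)] by simp }
qed

text \<open>
The ball of radius \<open>\<epsilon>\<^sub>k\<close> about an end of the gap does not reach across the gap, but two
doublings make it contain the edge piece on the other side if that piece is not longer than
the gap.
\<close>

lemma edge_pieces_le_gap_balls:
  assumes nb: "neighbours k t v v'" and le: "len (Suc (k + t)) \<le> gap k"
  shows "M (v @ [n (Suc (k + t))]) \<le> D ^ 2 * mass {lo v'..<lo v' + gap k}"
    "M (v' @ [Suc 0]) \<le> D ^ 2 * mass {hi v - gap k<..hi v}"
proof -
  note np = neighbours_props[OF nb]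
  have lv: "length v = k + t" "length v' = k + t" using np length_words by auto
  have g: "gap k > 0" using gap_pos[OF np(1)] .
  have hv: "hi (v @ [n (Suc (k + t))]) = hi v" using hi_last_piece[of v] lv by simp
  have a: "cyl n c (v @ [n (Suc (k + t))]) = {hi v - len (Suc (k + t))..hi v}"
    using hv lv by (simp add: cyl_eq) (simp add: hi_def)
  have b: "cyl n c (v' @ [Suc 0]) = {lo v'..lo v' + len (Suc (k + t))}"
    using lo_first_piece[of v'] lv by (simp add: cyl_eq) (simp add: hi_def)
  show "M (v @ [n (Suc (k + t))]) \<le> D ^ 2 * mass {lo v'..<lo v' + gap k}"
  proof (rule mass_compare[where x = "lo v'" and r = "gap k"])
    fix y assume "y \<in> E" "lo v' - gap k < y" "y < lo v' + gap k"
    then show "y \<in> {lo v'..<lo v' + gap k}" using np(4) np(5)[of y] by auto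
  qed (use lo_in_E[OF np(3)] g le np(4) in \<open>auto simp: a\<close>)
  show "M (v' @ [Suc 0]) \<le> D ^ 2 * mass {hi v - gap k<..hi v}"
  proof (rule mass_compare[where x = "hi v" and r = "gap k"])
    fix y assume "y \<in> E" "hi v - gap k < y" "y < hi v + gap k"
    then show "y \<in> {hi v - gap k<..hi v}" using np(4) np(5)[of y] by auto
  qed (use hi_in_E[OF np(2)] g le np(4) in \<open>auto simp: b\<close>)
qed

lemma M_piece_le: "e < n (Suc (length w)) \<Longrightarrow> M (w @ [Suc e]) \<le> M w"
  using cyl_piece_subset[of e w] by (intro mass_mono) auto

text \<open>
Either both components have a central point, or both consist of two pieces separated by a
gap so long that, by \<open>entries_across_large_gap\<close>, each piece carries a fixed share of the mass.
In the latter case it suffices to compare the pieces next to the gap.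
\<close>

lemma neighbours_dichotomy:
  assumes kL: "k \<in> Lambda n c" and nb: "neighbours k t v v'" and t: "t < m_idx n c k"
  shows "(M v \<le> D ^ 4 * M v' \<and> M v' \<le> D ^ 4 * M v) \<or>
    (n (Suc (k + t)) = 2 \<and> M v \<le> (1 + D ^ 2) * M (v @ [n (Suc (k + t))]) \<and> M v' \<le> (1 + D ^ 2) * M (v' @ [Suc 0]))"
proof (cases "n (Suc (k + t)) = 2 \<and> Suc (k + t) \<notin> Lambda n c")
  case True
  note np = neighbours_props[OF nb]
  define p q where "p = P (Suc (k + t)) ! 0" and "q = P (Suc (k + t)) ! 1"
  \<comment> \<open>two comparable numbers with sum \<open>1\<close> are bounded away from \<open>0\<close>\<close>
  have "p + q = 1" using P_sum[of "k + t"] True by (simp add: p_def q_def numeral_2_eq_2)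
  moreover have "p \<le> D ^ 2 * q" "q \<le> D ^ 2 * p"
    using entries_across_large_gap[of "k + t" 0] True by (auto simp: p_def q_def)
  ultimately have "1 \<le> (1 + D ^ 2) * q" "1 \<le> (1 + D ^ 2) * p" by (auto simp: distrib_right)
  note this[THEN mult_right_mono]
  from this(1)[OF mass_nonneg, of "cyl n c v"] this(2)[OF mass_nonneg, of "cyl n c v'"]
  have "1 * M v \<le> (1 + D ^ 2) * q * M v" "1 * M v' \<le> (1 + D ^ 2) * p * M v'" by auto
  moreover have "M (v @ [n (Suc (k + t))]) = q * M v" "M (v' @ [Suc 0]) = p * M v'"
    using M_piece[OF np(2), of 1] M_piece[OF np(3), of 0] True
      by (auto simp: p_def q_def numeral_2_eq_2)
  ultimately show ?thesis using True by (simp add: mult.assoc)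
next
  case False
  note np = neighbours_props[OF nb]
  have lv: "length v = k + t" "length v' = k + t" using np length_words by auto
  have l: "len (k + t) > 0" by (rule len_pos)
  have "gap k < len (k + t)"
    using m_idx_props[OF kL] t len_mono[of "k + t" "k + m_idx n c k - 1"] by fastforce
  then have near: "lo v' < hi v + len (k + t)" "hi v < lo v'" using np(4) gap_pos[OF np(1)]
    by auto
  have hv: "hi v = lo v + len (k + t)" "hi v' = lo v' + len (k + t)" by (simp_all add: hi_def lv)
  obtain x where x: "x \<in> E" "lo v + len (k + t) / 4 \<le> x" "x \<le> hi v - len (k + t) / 4"
    using central_point[OF np(2) False] by blast
  obtain x' where x': "x' \<in> E" "lo v' + len (k + t) / 4 \<le> x'" "x' \<le> hi v' - len (k + t) / 4"
    using central_point[OF np(3) False] by blast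
  have "M v' \<le> D ^ 4 * M v"
    using x near hv l by (intro mass_compare[where x = x
      and r = "len (k + t) / 4"]) (auto simp: cyl_eq)
  moreover have "M v \<le> D ^ 4 * M v'"
    using x' near hv l by (intro mass_compare[where x = x'
      and r = "len (k + t) / 4"]) (auto simp: cyl_eq)
  ultimately show ?thesis by blast
qed

text \<open>
Induction on the number \<open>r\<close> of levels that remain until \<open>k + m\<^sub>k\<close>. In the second case of the
dichotomy the induction hypothesis for the edge pieces applies; when no level remains, the
edge pieces are not longer than the gap, and balls about the ends of the gap compare them
with the component opposite, which is still longer than the gap.
\<close>

lemma neighbours_comparable_within:
  assumes kL: "k \<in> Lambda n c" and "neighbours k t v v'" "t + Suc r = m_idx n c k"
  shows "M v \<le> D ^ 4 * (1 + D ^ 2) ^ Suc r * M v' \<and> M v' \<le> D ^ 4 * (1 + D ^ 2) ^ Suc r * M v"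
  using assms(2,3)
proof (induction r arbitrary: t v v')
  case (0 t v v')
  note nb = 0(1) and np = neighbours_props[OF 0(1)]
  define j where "j = Suc (k + t)"
  define B where "B = 1 + D ^ 2"
  have lv: "length v = k + t" "length v' = k + t" using np length_words by auto
  have B: "B \<ge> 1" by (simp add: B_def)
  have "m_idx n c k = Suc t" using 0 by simp
  then have m: "len j \<le> gap k" "gap k < len (k + t)" using m_idx_props[OF kL]
    by (simp_all add: j_def)
  have D24: "D ^ 2 \<le> D ^ 4" using D by (intro power_increasing) auto
  from neighbours_dichotomy[OF kL nb] 0(2)
  consider "M v \<le> D ^ 4 * M v'" "M v' \<le> D ^ 4 * M v"
    | "M v \<le> B * M (v @ [n j])" "M v' \<le> B * M (v' @ [Suc 0])" by (auto simp: j_def B_def)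
  then have "M v \<le> D ^ 4 * B * M v' \<and> M v' \<le> D ^ 4 * B * M v"
  proof cases
    case 1
    have "D ^ 4 * z \<le> D ^ 4 * B * z" if "z \<ge> 0" for z
      using that B D mult_right_mono[OF B, of "D ^ 4 * z"] by (simp add: mult_ac)
    then show ?thesis using 1 mass_nonneg order_trans by blast
  next
    case 2
    have "M (v @ [n j]) \<le> D ^ 2 * mass {lo v'..<lo v' + gap k}"
      "M (v' @ [Suc 0]) \<le> D ^ 2 * mass {hi v - gap k<..hi v}"
      using edge_pieces_le_gap_balls[OF nb] m by (auto simp: j_def)
    moreover have "mass {lo v'..<lo v' + gap k} \<le> M v'" "mass {hi v - gap k<..hi v} \<le> M v"
      using m lv by (auto intro!: mass_mono simp: cyl_eq hi_def)
    then have "D ^ 2 * mass {lo v'..<lo v' + gap k} \<le> D ^ 4 * M v'"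
      "D ^ 2 * mass {hi v - gap k<..hi v} \<le> D ^ 4 * M v"
      using D24 by (auto intro!: mult_mono)
    ultimately have "M (v @ [n j]) \<le> D ^ 4 * M v'" "M (v' @ [Suc 0]) \<le> D ^ 4 * M v" by linarith+
    then have "B * M (v @ [n j]) \<le> B * (D ^ 4 * M v')" "B * M (v' @ [Suc 0]) \<le> B * (D ^ 4 * M v)"
      using B by (auto intro!: mult_left_mono)
    then show ?thesis using 2 by (simp add: mult_ac)
  qed
  then show ?case by (simp add: B_def)
next
  case (Suc r t v v')
  note nb = Suc.prems(1) and np = neighbours_props[OF Suc.prems(1)]
  define j where "j = Suc (k + t)"
  define B where "B = 1 + D ^ 2"
  define A where "A = D ^ 4 * B ^ Suc r"
  have lv: "length v = k + t" "length v' = k + t" using np length_words by auto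
  have B: "B \<ge> 1" by (simp add: B_def)
  have AB: "D ^ 4 * B ^ Suc (Suc r) = B * A" by (simp add: A_def)
  have A: "0 \<le> A" using D B by (simp add: A_def)
  from neighbours_dichotomy[OF kL nb] Suc.prems(2)
  consider "M v \<le> D ^ 4 * M v'" "M v' \<le> D ^ 4 * M v"
    | "n j = 2" "M v \<le> B * M (v @ [n j])" "M v' \<le> B * M (v' @ [Suc 0])"
      by (auto simp: j_def B_def)
  then have "M v \<le> B * A * M v' \<and> M v' \<le> B * A * M v"
  proof cases
    case 1
    have "D ^ 4 * z \<le> B * A * z" if "z \<ge> 0" for z
      unfolding AB[symmetric] using that D mult_right_mono[OF one_le_power[OF B, of "Suc (Suc r)"], of "D ^ 4 * z"]
      by (simp add: mult_ac)
    then show ?thesis using 1 mass_nonneg order_trans by blast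
  next
    case 2
    have nbj: "neighbours k (Suc t) (v @ [n j]) (v' @ [Suc 0])" using neighbours_Suc[OF nb]
      by (simp add: j_def)
    have IH: "M (v @ [n j]) \<le> A * M (v' @ [Suc 0])" "M (v' @ [Suc 0]) \<le> A * M (v @ [n j])"
      using Suc.IH[OF nbj] Suc.prems(2) unfolding A_def B_def by auto
    have "M (v' @ [Suc 0]) \<le> M v'" "M (v @ [n j]) \<le> M v"
      using M_piece_le[of 0 v'] M_piece_le[of 1 v] lv 2(1) by (auto simp: j_def numeral_2_eq_2)
    then have "A * M (v' @ [Suc 0]) \<le> A * M v'" "A * M (v @ [n j]) \<le> A * M v"
      using A by (auto intro!: mult_left_mono)
    then have "M (v @ [n j]) \<le> A * M v'" "M (v' @ [Suc 0]) \<le> A * M v" using IH by linarith+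
    then have "B * M (v @ [n j]) \<le> B * (A * M v')" "B * M (v' @ [Suc 0]) \<le> B * (A * M v)"
      using B by (auto intro!: mult_left_mono)
    then show ?thesis using 2 by (simp add: mult_ac)
  qed
  then show ?case by (fold B_def) (simp only: AB)
qed

context
  fixes m :: nat
  assumes m_bound: "\<And>k. k \<in> Lambda n c \<Longrightarrow> m_idx n c k \<le> m"
begin

text \<open>
The bound of \<open>neighbours_comparable_within\<close> for the largest possible number of levels. It also
bounds the ratio of adjacent entries of each vector.
\<close>

definition edge_const where "edge_const = D ^ 4 * (1 + D ^ 2) ^ m"

lemma edge_const_ge: "D ^ 2 \<le> edge_const" "1 \<le> edge_const"
proof -
  have "1 * D ^ 2 \<le> (1 + D ^ 2) ^ m * D ^ 4"
    using D by (intro mult_mono power_increasing one_le_power) auto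
  then show "D ^ 2 \<le> edge_const" by (simp add: edge_const_def mult.commute)
  then show "1 \<le> edge_const" using one_le_power[OF D, of 2] by linarith
qed

lemma neighbours_comparable:
  assumes kL: "k \<in> Lambda n c" and nb: "neighbours k t v v'" and t: "t < m_idx n c k"
  shows "M v \<le> edge_const * M v'" "M v' \<le> edge_const * M v"
proof -
  define r where "r = m_idx n c k - Suc t"
  have r: "t + Suc r = m_idx n c k" "Suc r \<le> m" using t m_bound[OF kL] by (auto simp: r_def)
  have le: "D ^ 4 * (1 + D ^ 2) ^ Suc r \<le> edge_const"
    unfolding edge_const_def using D r by (intro mult_left_mono power_increasing) auto
  have "D ^ 4 * (1 + D ^ 2) ^ Suc r * z \<le> edge_const * z" if "z \<ge> 0" for z
    using le that by (rule mult_right_mono)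
  then show "M v \<le> edge_const * M v'" "M v' \<le> edge_const * M v"
    using neighbours_comparable_within[OF kL nb r(1)] mass_nonneg order_trans by blast+
qed

lemma adjacent_entries_comparable:
  assumes e: "Suc e < n (Suc k)"
  shows "P (Suc k) ! e \<le> edge_const * P (Suc k) ! Suc e"
    "P (Suc k) ! Suc e \<le> edge_const * P (Suc k) ! e"
proof -
  have pos: "0 < P (Suc k) ! e" "0 < P (Suc k) ! Suc e" using P_pos e by auto
  have "P (Suc k) ! e \<le> edge_const * P (Suc k) ! Suc e \<and> P (Suc k) ! Suc e \<le> edge_const * P (Suc k) ! e"
  proof (cases "Suc k \<in> Lambda n c")
    case True
    define w where "w = replicate k (1::nat)"
    have w: "w \<in> words n k" using leftmost_word by (simp add: w_def)
    note * = neighbours_comparable[OF True neighbours_0[OF w e]]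
    have "M (w @ [Suc e]) \<le> edge_const * M (w @ [Suc (Suc e)])"
      "M (w @ [Suc (Suc e)]) \<le> edge_const * M (w @ [Suc e])"
      using * m_idx_props(1)[OF True] by auto
    then have "P (Suc k) ! e * M w \<le> (edge_const * P (Suc k) ! Suc e) * M w"
      "P (Suc k) ! Suc e * M w \<le> (edge_const * P (Suc k) ! e) * M w"
      using M_piece[OF w] e by auto
    then show ?thesis using M_pos[OF w] by simp
  next
    case False
    have "D ^ 2 * P (Suc k) ! Suc e \<le> edge_const * P (Suc k) ! Suc e"
      "D ^ 2 * P (Suc k) ! e \<le> edge_const * P (Suc k) ! e"
      using edge_const_ge pos by (auto intro!: mult_right_mono)
    then show ?thesis using entries_across_large_gap[OF False e] by linarith
  qed
  then show "P (Suc k) ! e \<le> edge_const * P (Suc k) ! Suc e"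
    "P (Suc k) ! Suc e \<le> edge_const * P (Suc k) ! e" by auto
qed

section \<open>Comparing windows under a doubling measure\<close>

text \<open>
Equally spaced intervals of length \<open>d\<close> with left endpoints \<open>a e\<close> and spacing \<open>u\<close>, up to one
irregular gap: the irregularity shortens a distance by at most \<open>u\<close> and lengthens it by at most
\<open>b\<close>. The intervals cover the part of \<open>E\<close> in their convex hull. The definition describes at the
same time the pieces of one component and the pieces of two neighbouring components.
\<close>

definition interval_row :: "(nat \<Rightarrow> real) \<Rightarrow> real \<Rightarrow> real \<Rightarrow> real \<Rightarrow> nat \<Rightarrow> bool" where
  "interval_row a d u b T \<longleftrightarrow> 0 < d \<and> d \<le> u \<and> (\<forall>e<T. a e \<in> E) \<and>
    (\<forall>e f. e < f \<longrightarrow> f < T \<longrightarrow> a e + d < a f \<and>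
       (real f - real e - 1) * u \<le> a f - a e \<and> a f - a e \<le> (real f - real e) * u + b) \<and>
    (\<forall>y\<in>E. a 0 \<le> y \<longrightarrow> y \<le> a (T - 1) + d \<longrightarrow> (\<exists>e<T. a e \<le> y \<and> y \<le> a e + d))"

text \<open>
The left endpoint of the interval in the middle of a window of \<open>l \<ge> 6\<close> intervals has distance
at least \<open>l * u / 8\<close> from the complement of the window. All of a window shifted by at most \<open>l\<close>
lies within \<open>8 * l * u\<close> of it, since the irregular gap adds at most \<open>2 * l * u\<close>.
\<close>

lemma long_windows_comparable:
  assumes row: "interval_row a d u b T" and b: "0 \<le> b" "b \<le> 2 * real l * u"
    and l: "6 \<le> l" "i + l \<le> T" "j + l \<le> T" "i \<le> j + l" "j \<le> i + l"
  shows "(\<Sum>e=j..<j+l. mass {a e..a e + d}) \<le> D ^ 6 * (\<Sum>e=i..<i+l. mass {a e..a e + d})"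
proof -
  from row have u: "0 < d" "d \<le> u" "0 < u" and E: "\<And>e. e < T \<Longrightarrow> a e \<in> E"
    and step: "\<And>e f. e < f \<Longrightarrow> f < T \<Longrightarrow> a e + d < a f"
    and lower: "\<And>e f. e < f \<Longrightarrow> f < T \<Longrightarrow> (real f - real e - 1) * u \<le> a f - a e"
    and upper: "\<And>e f. e < f \<Longrightarrow> f < T \<Longrightarrow> a f - a e \<le> (real f - real e) * u + b"
    and cover: "\<And>y. y \<in> E \<Longrightarrow> a 0 \<le> y \<Longrightarrow> y \<le> a (T - 1) + d \<Longrightarrow> \<exists>e<T. a e \<le> y \<and> y \<le> a e + d"
    unfolding interval_row_def by auto
  have mono: "a e \<le> a f" if "e \<le> f" "f < T" for e f
    using step[of e f] that u by (cases "e = f") auto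
  have disj: "disjoint_family_on (\<lambda>e. {a e..a e + d}) {r..<r+l}" if "r + l \<le> T" for r
    unfolding disjoint_family_on_def
  proof (intro ballI impI)
    fix e f assume ef: "e \<in> {r..<r+l}" "f \<in> {r..<r+l}" "e \<noteq> f"
    then have "a e + d < a f \<or> a f + d < a e" using step[of e f] step[of f e] that
      by (cases "e < f") auto
    then show "{a e..a e + d} \<inter> {a f..a f + d} = {}" using u by auto
  qed
  have sum: "(\<Sum>e=r..<r+l. mass {a e..a e + d}) = mass (\<Union>e\<in>{r..<r+l}. {a e..a e + d})"
    if "r + l \<le> T" for r
    using disj[OF that] by (subst mass_Union) auto
  define h where "h = l div 2"
  define U where "U = real l * u"
  have U: "0 < U" using u l by (simp add: U_def)
  have h: "1 < h" "i + h < i + l - 1" "real l \<le> 8 * (real h - 1)"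
    "real l \<le> 8 * (real l - 1 - real h - 1)"
  proof -
    have "1 < h" "i + h < i + l - 1" "l + 8 \<le> 8 * h" "l + 8 * h + 16 \<le> 8 * l"
      using l(1) unfolding h_def by arith+
    moreover from this have "real (l + 8) \<le> real (8 * h)" "real (l + 8 * h + 16) \<le> real (8 * l)"
      by (simp_all only: of_nat_le_iff)
    ultimately show "1 < h" "i + h < i + l - 1" "real l \<le> 8 * (real h - 1)"
      "real l \<le> 8 * (real l - 1 - real h - 1)" by simp_all
  qed
  show ?thesis unfolding sum[OF l(2)] sum[OF l(3)]
  proof (rule mass_compare[where x = "a (i + h)" and r = "U / 8"])
    show "a (i + h) \<in> E" using h l by (intro E) auto
    show "0 < U / 8" using U by simp
    show "(\<Union>e\<in>{i..<i+l}. {a e..a e + d}) \<in> sets borel" by (intro sets.finite_UN) auto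
    fix y assume y: "y \<in> E" "a (i + h) - U / 8 < y" "y < a (i + h) + U / 8"
    have "real l * u \<le> 8 * (real h - 1) * u" using h u by (intro mult_right_mono) auto
    then have "U \<le> 8 * ((real h - 1) * u)" by (simp only: U_def mult.assoc)
    moreover have "(real h - 1) * u \<le> a (i + h) - a i" using lower[of i "i + h"] h l by simp
    ultimately have "U / 8 \<le> a (i + h) - a i" by linarith
    then have y1: "a i < y" using y by simp
    have "real l * u \<le> 8 * (real l - 1 - real h - 1) * u" using h u
      by (intro mult_right_mono) auto
    then have "U \<le> 8 * ((real l - 1 - real h - 1) * u)" by (simp only: U_def mult.assoc)
    moreover have "real (i + l - 1) - real (i + h) - 1 = real l - 1 - real h - 1" using l
      by (simp add: of_nat_diff)
    then have "(real l - 1 - real h - 1) * u \<le> a (i + l - 1) - a (i + h)"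
      using lower[of "i + h" "i + l - 1"] h l by simp
    ultimately have "U / 8 \<le> a (i + l - 1) - a (i + h)" by linarith
    then have y2: "y < a (i + l - 1)" using y by simp
    have "a 0 \<le> y" using y1 mono[of 0 i] l by simp
    moreover have "i + l - 1 \<le> T - 1" "T - 1 < T" using l by auto
    then have "y \<le> a (T - 1) + d" using y2 mono[of "i + l - 1" "T - 1"] u by linarith
    ultimately obtain e where e: "e < T" "a e \<le> y" "y \<le> a e + d" using cover[OF y(1)] by blast
    have "\<not> e < i" using step[of e i] e y1 l by auto
    moreover have "\<not> i + l - 1 < e" using mono[of "i + l - 1" e] e y2 by auto
    ultimately show "y \<in> (\<Union>e\<in>{i..<i+l}. {a e..a e + d})" using e l by auto
  next
    fix y assume "y \<in> (\<Union>e\<in>{j..<j+l}. {a e..a e + d})"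
    then obtain e where e: "j \<le> e" "e < j + l" "a e \<le> y" "y \<le> a e + d" by auto
    have hl: "h \<le> l" by (simp add: h_def)
    have far: "real e - real (i + h) \<le> 2 * real l" "real (i + h) - real e \<le> 2 * real l"
      using e l hl by linarith+
    have "\<bar>a e - a (i + h)\<bar> \<le> 2 * U + b"
    proof (rule linorder_cases[of e "i + h"])
      assume "e < i + h"
      then have "a (i + h) - a e \<le> (real (i + h) - real e) * u + b" "a e + d < a (i + h)"
        using upper[of e "i + h"] step[of e "i + h"] h l by auto
      moreover have "(real (i + h) - real e) * u \<le> 2 * real l * u" using far u
        by (intro mult_right_mono) auto
      then have "(real (i + h) - real e) * u \<le> 2 * U" by (simp only: U_def mult.assoc)
      ultimately show ?thesis using u by linarith
    next
      assume "i + h < e"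
      then have "a e - a (i + h) \<le> (real e - real (i + h)) * u + b" "a (i + h) + d < a e"
        using upper[of "i + h" e] step[of "i + h" e] e l by auto
      moreover have "(real e - real (i + h)) * u \<le> 2 * real l * u" using far u
        by (intro mult_right_mono) auto
      then have "(real e - real (i + h)) * u \<le> 2 * U" by (simp only: U_def mult.assoc)
      ultimately show ?thesis using u by linarith
    next
      assume "e = i + h"
      then show ?thesis using U b by simp
    qed
    moreover have "1 * u \<le> real l * u" using l u by (intro mult_right_mono) auto
    then have "u \<le> U" by (simp only: U_def mult_1)
    then have "d \<le> U" using u by linarith
    moreover have "b \<le> 2 * U" using b by (simp only: U_def mult.assoc)
    ultimately show "a (i + h) - 2 ^ 6 * (U / 8) < y \<and> y < a (i + h) + 2 ^ 6 * (U / 8)"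
      using e U by (auto simp: abs_le_iff)
  qed
qed

text \<open>
Long windows are comparable by themselves. Windows with fewer than six intervals occur only
if \<open>s < 6\<close>, and only then does the comparison of adjacent intervals have to be supplied.
\<close>

lemma row_windows_comparable:
  assumes row: "interval_row a d u b T" and b: "0 \<le> b" "b \<le> 2 * real s * u" and K': "K' \<ge> 1"
    and adj: "\<And>e. s < 6 \<Longrightarrow> Suc e < T \<Longrightarrow> mass {a e..a e + d} \<le> K' * mass {a (Suc e)..a (Suc e) + d} \<and>
       mass {a (Suc e)..a (Suc e) + d} \<le> K' * mass {a e..a e + d}"
    and l: "s \<le> l" "i + l \<le> T" "j + l \<le> T" "i \<le> j + l" "j \<le> i + l"
  shows "(\<Sum>e=j..<j+l. mass {a e..a e + d}) \<le> D ^ 6 * K' ^ 5 * (\<Sum>e=i..<i+l. mass {a e..a e + d})"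
proof -
  define q where "q e = mass {a e..a e + d}" for e
  have q: "q e \<ge> 0" for e by (simp add: q_def)
  have ge: "D ^ 6 \<ge> 1" "K' ^ 5 \<ge> 1" using D K' by auto
  have S: "(\<Sum>e=i..<i+l. q e) \<ge> 0" using q by (simp add: sum_nonneg)
  show ?thesis
  proof (cases "6 \<le> l")
    case True
    have "0 \<le> u" using row by (auto simp: interval_row_def)
    then have "2 * real s * u \<le> 2 * real l * u" using l by (intro mult_right_mono) auto
    then have "(\<Sum>e=j..<j+l. q e) \<le> D ^ 6 * 1 * (\<Sum>e=i..<i+l. q e)"
      unfolding q_def using long_windows_comparable[OF row b(1) _ True l(2-5)] b(2) by simp
    also have "\<dots> \<le> D ^ 6 * K' ^ 5 * (\<Sum>e=i..<i+l. q e)"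
      using ge S by (intro mult_right_mono mult_left_mono) auto
    finally show ?thesis by (simp add: q_def)
  next
    case False
    have "q (e + j) \<le> K' ^ 5 * q (e + i)" if "e < l" for e
      using adj l False that K'
        by (intro comparable_along_chain[where T = T] q) (auto simp: q_def)
    then have "(\<Sum>e=0..<l. q (e + j)) \<le> (\<Sum>e=0..<l. K' ^ 5 * q (e + i))"
      by (intro sum_mono) auto
    then have "(\<Sum>e=j..<j+l. q e) \<le> 1 * K' ^ 5 * (\<Sum>e=i..<i+l. q e)"
      using sum.shift_bounds_nat_ivl[of q 0 j l] sum.shift_bounds_nat_ivl[of q 0 i l]
      by (simp add: sum_distrib_left add.commute)
    also have "\<dots> \<le> D ^ 6 * K' ^ 5 * (\<Sum>e=i..<i+l. q e)"
      using ge S K' by (intro mult_right_mono) auto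
    finally show ?thesis by (simp add: q_def)
  qed
qed

lemma row_of_pieces:
  assumes w: "w \<in> words n k"
  shows "interval_row (\<lambda>e. lo (w @ [Suc e])) (len (Suc k)) (pitch (Suc k)) 0 (n (Suc k))"
proof -
  have lw: "length w = k" using w length_words by auto
  have piece: "cyl n c (w @ [Suc e]) = {lo (w @ [Suc e])..lo (w @ [Suc e]) + len (Suc k)}" for e
    by (simp add: cyl_eq hi_def lw)
  have pp: "pitch (Suc k) > 0" by (simp add: pitch_pos)
  show ?thesis unfolding interval_row_def
  proof (intro conjI allI impI ballI)
    fix e f :: nat assume "e < f"
    then show "lo (w @ [Suc e]) + len (Suc k) < lo (w @ [Suc f])"
      using hi_piece_less[of e f w] gap_pos[of "Suc k"] by (simp add: hi_def lw)
    show "(real f - real e - 1) * pitch (Suc k) \<le> lo (w @ [Suc f]) - lo (w @ [Suc e])"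
      "lo (w @ [Suc f]) - lo (w @ [Suc e]) \<le> (real f - real e) * pitch (Suc k) + 0"
      using pp by (simp_all add: lo_piece lw algebra_simps)
  next
    fix y assume y: "y \<in> E" "lo (w @ [Suc 0]) \<le> y"
      "y \<le> lo (w @ [Suc (n (Suc k) - 1)]) + len (Suc k)"
    have "hi (w @ [Suc (n (Suc k) - 1)]) = hi w"
      using hi_last_piece[of w] branches[of k] by (simp add: lw)
    then have "y \<in> cyl n c w" using y by (simp add: cyl_eq lo_first_piece hi_def lw)
    then show "\<exists>e<n (Suc k). lo (w @ [Suc e]) \<le> y \<and> y \<le> lo (w @ [Suc e]) + len (Suc k)"
      using E_piece[OF y(1) w] piece by (metis atLeastAtMost_iff)
  qed (use len_pos len_le_pitch w in \<open>auto intro!: lo_in_E[of _ "Suc k"] simp: words_snoc_iff\<close>)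
qed

lemma uniform_if_doubling: "C_uniform (D ^ 6 * edge_const ^ 5) (P (Suc k))"
  unfolding C_uniform_def Cs_uniform_iff
proof (intro conjI allI impI)
  have "1 * 1 \<le> D ^ 6 * edge_const ^ 5" using D edge_const_ge
    by (intro mult_mono one_le_power) auto
  then show "1 \<le> D ^ 6 * edge_const ^ 5" by simp
  show "1 \<le> length (P (Suc k))" using branches[of k] by (simp add: length_P)
  fix i j l assume l: "1 \<le> l" "i + l \<le> length (P (Suc k))" "j + l \<le> length (P (Suc k))"
    "i \<le> j + l" "j \<le> i + l"
  define w where "w = replicate k (1::nat)"
  have w: "w \<in> words n k" using leftmost_word by (simp add: w_def)
  have lw: "length w = k" by (simp add: w_def)
  define q where "q e = mass {lo (w @ [Suc e])..lo (w @ [Suc e]) + len (Suc k)}" for e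
  have q: "q e = P (Suc k) ! e * M w" if "e < n (Suc k)" for e
    using M_piece[OF w that] by (simp add: q_def cyl_eq hi_def lw)
  have adj: "q e \<le> edge_const * q (Suc e) \<and> q (Suc e) \<le> edge_const * q e"
    if "Suc e < n (Suc k)" for e
    using mult_right_mono[OF adjacent_entries_comparable(1)[OF that], of "M w"]
      mult_right_mono[OF adjacent_entries_comparable(2)[OF that], of "M w"] that by (simp add: q)
  have "(\<Sum>e=i..<i+l. q e) \<le> D ^ 6 * edge_const ^ 5 * (\<Sum>e=j..<j+l. q e)"
    unfolding q_def using adj l edge_const_ge pitch_pos[of "Suc k"] unfolding q_def
    by (intro row_windows_comparable[OF row_of_pieces[OF w], where s = 1]) (auto simp: length_P)
  moreover have "(\<Sum>e=r..<r+l. q e) = M w * win (P (Suc k)) r l" if "r + l \<le> n (Suc k)" for r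
    using that by (auto simp: win_def sum_distrib_left q mult.commute intro!: sum.cong)
  ultimately have "M w * win (P (Suc k)) i l \<le> D ^ 6 * edge_const ^ 5 * (M w * win (P (Suc k)) j l)"
    using l by (simp add: length_P)
  then have "M w * win (P (Suc k)) i l \<le> M w * (D ^ 6 * edge_const ^ 5 * win (P (Suc k)) j l)"
    by (simp add: mult_ac)
  then show "win (P (Suc k)) i l \<le> D ^ 6 * edge_const ^ 5 * win (P (Suc k)) j l"
    using M_pos[OF w] by simp
qed (use P_vector in auto)

text \<open>
The row continues across the gap of level \<open>k\<close> with the shift \<open>\<epsilon>\<^sub>k - \<epsilon>\<^sub>j\<close> of all later endpoints.
\<close>

lemma row_of_neighbouring_pieces:
  assumes nb: "neighbours k t v v'" and j: "j = Suc (k + t)"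
  shows "interval_row (\<lambda>e. if e < n j then lo (v @ [Suc e]) else lo (v' @ [Suc (e - n j)]))
    (len j) (pitch j) (gap k) (n j + n j)"
proof -
  note np = neighbours_props[OF nb]
  have lv: "length v = k + t" "length v' = k + t" using np length_words by auto
  define a where "a e = (if e < n j then lo (v @ [Suc e]) else lo (v' @ [Suc (e - n j)]))" for e
  have g: "0 < gap j" "0 < len j" "pitch j = len j + gap j" "0 < pitch j" "0 < gap k"
    using gap_pos[of j] gap_pos[OF np(1)] len_pos pitch_pos[of j] by (auto simp: j pitch_def)
  have hv: "lo v' = lo v + real (n j) * pitch j - gap j + gap k"
    using np(4) len_split[of "k + t"] by (simp add: hi_def lv j)
  have a: "a e = lo v + real e * pitch j + (if e < n j then 0 else gap k - gap j)" for e
    using hv by (auto simp: a_def lo_piece lv j of_nat_diff algebra_simps)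
  have N: "n j \<ge> 2" using branches by (simp add: j)
  have "interval_row a (len j) (pitch j) (gap k) (n j + n j)" unfolding interval_row_def
  proof (intro conjI allI impI ballI)
    fix e f :: nat assume ef: "e < f"
    have "real (Suc e) * pitch j \<le> real f * pitch j" using ef g by (intro mult_right_mono) auto
    then have "real e * pitch j + pitch j \<le> real f * pitch j" by (simp add: algebra_simps)
    then show "a e + len j < a f"
      using g ef by (auto simp: a)
    show "(real f - real e - 1) * pitch j \<le> a f - a e"
      "a f - a e \<le> (real f - real e) * pitch j + gap k"
      using g ef by (auto simp: a algebra_simps)
  next
    fix y assume y: "y \<in> E" "a 0 \<le> y" "y \<le> a (n j + n j - 1) + len j"
    have "hi (v' @ [Suc (n j - 1)]) = hi v'" using hi_last_piece[of v'] N by (simp add: lv j)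
    moreover have "n j + n j - 1 - n j = n j - 1" "\<not> n j + n j - 1 < n j" using N by auto
    ultimately have y2: "y \<le> hi v'" using y(3) by (simp add: a_def hi_def lv j)
    have y1: "lo v \<le> y" using y(2) N by (simp add: a_def lo_first_piece split: if_splits)
    have p: "cyl n c (z @ [Suc e]) = {lo (z @ [Suc e])..lo (z @ [Suc e]) + len j}"
      if "length z = k + t" for z e
      using that by (simp add: cyl_eq hi_def j)
    from np(5)[OF y(1)] show "\<exists>e<n j + n j. a e \<le> y \<and> y \<le> a e + len j"
    proof
      assume "y \<le> hi v"
      then have "y \<in> cyl n c v" using y1 by (simp add: cyl_eq)
      then obtain e where "e < n j" "y \<in> cyl n c (v @ [Suc e])" using E_piece[OF y(1) np(2)] j
        by blast
      then show ?thesis using p[OF lv(1)] by (intro exI[of _ e]) (auto simp: a_def)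
    next
      assume "lo v' \<le> y"
      then have "y \<in> cyl n c v'" using y2 by (simp add: cyl_eq)
      then obtain e where "e < n j" "y \<in> cyl n c (v' @ [Suc e])"
        using E_piece[OF y(1) np(3)] j by blast
      then show ?thesis using p[OF lv(2)] by (intro exI[of _ "n j + e"]) (auto simp: a_def)
    qed
  next
    fix e assume "e < n j + n j"
    then show "a e \<in> E" using np N
      by (auto simp: a_def j words_snoc_iff intro!: lo_in_E[of _ "Suc (k + t)"])
  qed (use g in auto)
  then show ?thesis by (simp add: a_def[abs_def])
qed

text \<open>
The masses of the pieces of two neighbours are the entries of \<open>(P\<^sub>j, P\<^sub>j)\<close>, each half multiplied
by the mass of one of the components. These masses are comparable, so that the comparison of
windows carries over from the masses to the vector at the cost of the factor
\<open>edge_const\<^sup>2\<close>.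
\<close>

lemma uniform_append_if_doubling:
  assumes kL: "k \<in> Lambda n c" and nb: "neighbours k t v v'" and t: "t < m_idx n c k"
    and j: "j = Suc (k + t)"
    and K': "edge_const \<le> K'" and s: "1 \<le> s" "s \<le> n j" "gap k \<le> 2 * real s * pitch j"
    and middle: "s < 6 \<Longrightarrow> M (v @ [n j]) \<le> K' * M (v' @ [Suc 0]) \<and> M (v' @ [Suc 0]) \<le> K' * M (v @ [n j])"
  shows "Cs_uniform (edge_const ^ 2 * (D ^ 6 * K' ^ 5)) s (P j @ P j)"
  unfolding Cs_uniform_iff
proof (intro conjI allI impI)
  note np = neighbours_props[OF nb]
  have lv: "length v = k + t" "length v' = k + t" using np length_words by auto
  have K1: "K' \<ge> 1" using K' edge_const_ge by linarith
  have "1 * (1 * 1) \<le> edge_const ^ 2 * (D ^ 6 * K' ^ 5)" using D K1 edge_const_ge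
    by (intro mult_mono one_le_power) auto
  then show "1 \<le> edge_const ^ 2 * (D ^ 6 * K' ^ 5)" by simp
  define N where "N = n j"
  define Q where "Q = P j"
  have lQ: "length Q = N" by (simp add: Q_def N_def j length_P)
  have N: "N \<ge> 2" using branches by (simp add: N_def j)
  show "s \<le> length (P j @ P j)" using s lQ by (simp add: Q_def N_def)
  have Qpos: "\<forall>x\<in>set Q. x > 0" using P_vector by (auto simp: Q_def j)
  then show "\<forall>x\<in>set (P j @ P j). 0 < x" by (simp add: Q_def)
  fix x y l assume l: "s \<le> l" "x + l \<le> length (P j @ P j)" "y + l \<le> length (P j @ P j)"
    "x \<le> y + l" "y \<le> x + l"
  define a where "a e = (if e < N then lo (v @ [Suc e]) else lo (v' @ [Suc (e - N)]))" for e
  define q where "q e = mass {a e..a e + len j}" for e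
  have row: "interval_row a (len j) (pitch j) (gap k) (N + N)"
    unfolding a_def[abs_def] N_def by (rule row_of_neighbouring_pieces[OF nb j])
  have q1: "q e = Q ! e * M v" if "e < N" for e
    using M_piece[OF np(2), of e] that by (simp add: q_def a_def cyl_eq hi_def lv j N_def Q_def)
  have q2: "q (N + e) = Q ! e * M v'" if "e < N" for e
    using M_piece[OF np(3), of e] that by (simp add: q_def a_def cyl_eq hi_def lv j N_def Q_def)
  have adjQ: "Q ! e \<le> K' * Q ! Suc e \<and> Q ! Suc e \<le> K' * Q ! e" if "Suc e < N" for e
  proof -
    have "edge_const * Q ! Suc e \<le> K' * Q ! Suc e" "edge_const * Q ! e \<le> K' * Q ! e"
      using K' Qpos lQ that by (auto intro!: mult_right_mono less_imp_le)
    then show ?thesis using adjacent_entries_comparable[of e "k + t"] that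
      by (auto simp: Q_def N_def j)
  qed
  have adj: "q e \<le> K' * q (Suc e) \<and> q (Suc e) \<le> K' * q e" if s6: "s < 6"
    and e: "Suc e < N + N" for e
  proof -
    consider "Suc e < N" | "Suc e = N" | "N \<le> e" by linarith
    then show ?thesis
    proof cases
      case 1
      then show ?thesis
        using adjQ[OF 1, THEN conjunct1, THEN mult_right_mono, of "M v"]
          adjQ[OF 1, THEN conjunct2, THEN mult_right_mono, of "M v"] by (simp add: q1)
    next
      case 2
      have "q e = M (v @ [n j])" "q (Suc e) = M (v' @ [Suc 0])"
        using 2 by (auto simp: q_def a_def cyl_eq hi_def lv j N_def)
      then show ?thesis using middle[OF s6] by simp
    next
      case 3
      then obtain f where f: "e = N + f" "Suc f < N" using e le_Suc_ex
        by (metis add_Suc_right nat_add_left_cancel_less)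
      then show ?thesis
        using adjQ[OF f(2), THEN conjunct1, THEN mult_right_mono, of "M v'"]
          adjQ[OF f(2), THEN conjunct2, THEN mult_right_mono, of "M v'"] q2[of f] q2[of "Suc f"] by simp
    qed
  qed
  have Mc: "M v \<le> edge_const * M v'" "M v' \<le> edge_const * M v"
    using neighbours_comparable[OF kL nb t] .
  \<comment> \<open>weights \<open>M v\<close> and \<open>M v'\<close> of the two halves are both replaced by \<open>M v\<close>\<close>
  have cmp: "(Q @ Q) ! e * M v \<le> edge_const * q e \<and> q e \<le> edge_const * ((Q @ Q) ! e * M v)"
    if e: "e < N + N" for e
  proof (cases "e < N")
    case True
    have "1 * (Q ! e * M v) \<le> edge_const * (Q ! e * M v)"
      using edge_const_ge Qpos lQ True
        by (intro mult_right_mono mult_nonneg_nonneg) (auto intro: less_imp_le)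
    then show ?thesis using True lQ by (simp add: q1 nth_append)
  next
    case False
    then obtain f where f: "e = N + f" "f < N" using e le_Suc_ex
      by (metis linorder_not_less nat_add_left_cancel_less)
    have "Q ! f * M v \<le> Q ! f * (edge_const * M v')" "Q ! f * M v' \<le> Q ! f * (edge_const * M v)"
      using Mc Qpos lQ f by (auto intro!: mult_left_mono less_imp_le)
    then show ?thesis using f q2[of f] lQ by (simp add: nth_append mult_ac)
  qed
  have wq: "win (Q @ Q) r l * M v \<le> edge_const * (\<Sum>e=r..<r+l. q e)"
    "(\<Sum>e=r..<r+l. q e) \<le> edge_const * (win (Q @ Q) r l * M v)"
    if "r + l \<le> N + N" for r
    unfolding win_def sum_distrib_left sum_distrib_right using cmp that by (auto intro!: sum_mono)
  have l': "x + l \<le> N + N" "y + l \<le> N + N" using l lQ by (simp_all add: Q_def)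
  have "win (Q @ Q) x l * M v \<le> edge_const * (\<Sum>e=x..<x+l. q e)" using wq(1)[OF l'(1)] .
  also have "\<dots> \<le> edge_const * (D ^ 6 * K' ^ 5 * (\<Sum>e=y..<y+l. q e))"
    unfolding q_def using adj[unfolded q_def] s l l' K1 edge_const_ge gap_pos[OF np(1)]
    by (intro mult_left_mono row_windows_comparable[OF row]) auto
  also have "\<dots> \<le> edge_const * (D ^ 6 * K' ^ 5 * (edge_const * (win (Q @ Q) y l * M v)))"
    using wq(2)[OF l'(2)] K1 edge_const_ge D by (intro mult_left_mono) auto
  also have "\<dots> = (edge_const ^ 2 * (D ^ 6 * K' ^ 5) * win (Q @ Q) y l) * M v"
    by (simp add: power2_eq_square mult_ac)
  finally show "win (P j @ P j) x l \<le> edge_const ^ 2 * (D ^ 6 * K' ^ 5) * win (P j @ P j) y l"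
    using M_pos[OF np(2)] by (simp add: Q_def)
qed (use s in auto)

lemma uniform_append_below:
  assumes kL: "k \<in> Lambda n c" and t: "1 \<le> t" "t < m_idx n c k"
  shows "C_uniform (edge_const ^ 2 * (D ^ 6 * edge_const ^ 5)) (P (k + t) @ P (k + t))"
proof -
  have k: "k \<ge> 1" using kL by (simp add: Lambda_def)
  obtain t' where t': "t = Suc t'" using t by (cases t) auto
  obtain v v' where nb: "neighbours k t' v v'" using ex_neighbours[OF k] by blast
  have j: "k + t = Suc (k + t')" using t' by simp
  have "gap k < len (k + t)"
    using m_idx_props[OF kL] t len_mono[of "k + t" "k + m_idx n c k - 1"] by fastforce
  then have g: "gap k \<le> 2 * real 1 * pitch (k + t)"
    using len_le_pitch[of "k + t'"] len_pos[of "k + t"] unfolding j by simp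
  have nb': "neighbours k t (v @ [n (k + t)]) (v' @ [Suc 0])"
    using neighbours_Suc[OF nb] by (simp add: t')
  show ?thesis unfolding C_uniform_def
    using neighbours_comparable[OF kL nb' t(2)] g branches[of "k + t'"] t
    by (intro uniform_append_if_doubling[OF kL nb _ j order_refl]) (auto simp: t')
qed

text \<open>
At level \<open>j = k + m\<^sub>k\<close> the gap can be longer than the pieces, but not longer than \<open>s\<^sub>k + 1\<close>
spacings. If \<open>s\<^sub>k \<ge> 6\<close>, all relevant windows are long. Otherwise a ball of radius \<open>\<epsilon>\<^sub>k\<close> about an
end of the gap meets at most six pieces on that side, all comparable with the edge piece,
which compares the two edge pieces with each other.
\<close>

lemma uniform_append_at:
  assumes kL: "k \<in> Lambda n c"
  defines "j \<equiv> k + m_idx n c k"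
  shows "Cs_uniform (edge_const ^ 2 * (D ^ 6 * (6 * D ^ 2 * edge_const ^ 5) ^ 5)) (s_idx n c k) (P j @ P j)"
proof -
  have k: "k \<ge> 1" using kL by (simp add: Lambda_def)
  obtain t where t: "m_idx n c k = Suc t" using m_idx_props(1)[OF kL]
    by (cases "m_idx n c k") auto
  have j: "j = Suc (k + t)" by (simp add: j_def t)
  obtain v v' where nb: "neighbours k t v v'" using ex_neighbours[OF k] by blast
  note np = neighbours_props[OF nb]
  have lv: "length v = k + t" "length v' = k + t" using np length_words by auto
  define s where "s = s_idx n c k"
  have s: "1 \<le> s" "s < n j" "gap k < real s * pitch j + len j"
    using s_idx_props[OF kL] by (auto simp: s_def j_def)
  have g1: "gap k < (real s + 1) * pitch j" using s len_le_pitch[of "k + t"] j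
    by (simp add: distrib_right)
  have p: "pitch j > 0" using pitch_pos[of j] j by simp
  have "(real s + 1) * pitch j \<le> (2 * real s) * pitch j" using s p by (intro mult_right_mono) auto
  then have g2: "gap k \<le> 2 * real s * pitch j" using g1 by linarith
  have g3: "gap k < len (k + t)" "len j \<le> gap k" using m_idx_props[OF kL] by (simp_all add: t j)
  have gp: "gap k > 0" using gap_pos[OF k] .
  have K1: "edge_const \<ge> 1" "edge_const ^ 5 \<ge> 1" "D ^ 2 \<ge> 1" using edge_const_ge D by auto
  define Q where "Q = P j"
  have lQ: "length Q = n j" by (simp add: Q_def j length_P)
  have Q: "Q ! e \<ge> 0" if "e < n j" for e using P_pos that
    by (auto simp: Q_def j intro: less_imp_le)
  have ends: "(\<Sum>e=a..<a + (s + 1). Q ! e) \<le> 6 * edge_const ^ 5 * Q ! f"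
    if s6: "s < 6" and f: "f < n j" "a \<le> f" "f \<le> a + s" "a + s < n j" for a f
  proof -
    have "(\<Sum>e=a..<a + (s + 1). Q ! e) \<le> (\<Sum>e=a..<a + (s + 1). edge_const ^ 5 * Q ! f)"
    proof (rule sum_mono)
      fix e assume "e \<in> {a..<a + (s + 1)}"
      then show "Q ! e \<le> edge_const ^ 5 * Q ! f"
        using s6 f K1 adjacent_entries_comparable[of _ "k + t"] Q
        by (intro comparable_along_chain[where T = "n j"]) (auto simp: Q_def j)
    qed
    also have "\<dots> = real (s + 1) * (edge_const ^ 5 * Q ! f)" by simp
    also have "\<dots> \<le> 6 * (edge_const ^ 5 * Q ! f)" using s6 K1 Q[OF f(1)]
      by (intro mult_right_mono) auto
    finally show ?thesis by simp
  qed
  have middle: "M (v @ [n j]) \<le> (6 * D ^ 2 * edge_const ^ 5) * M (v' @ [Suc 0]) \<and> M (v' @ [Suc 0]) \<le> (6 * D ^ 2 * edge_const ^ 5) * M (v @ [n j])"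
    if s6: "s < 6"
  proof -
    have Mv: "M (v @ [n j]) = Q ! (n j - 1) * M v" "M (v' @ [Suc 0]) = Q ! 0 * M v'"
      using M_piece[OF np(2), of "n j - 1"] M_piece[OF np(3), of 0] s by (auto simp: j Q_def)
    have "mass {lo v'..<lo v' + gap k} \<le> mass (\<Union>e\<in>{0..<s + 1}. cyl n c (v' @ [Suc e]))"
    proof (rule mass_mono)
      fix y assume y: "y \<in> E" "y \<in> {lo v'..<lo v' + gap k}"
      then have "y \<in> cyl n c v'" using g3 by (auto simp: cyl_eq hi_def lv)
      then obtain e where e: "e < n j" "y \<in> cyl n c (v' @ [Suc e])"
        using E_piece[OF y(1) np(3)] j by blast
      have "real e * pitch j < (real s + 1) * pitch j"
        using pos_in_piece(1)[OF lv(2) e(2)] y(2) g1 by (auto simp: j)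
      then have "e < s + 1" using p by (simp add: mult_less_cancel_right)
      then show "y \<in> (\<Union>e\<in>{0..<s + 1}. cyl n c (v' @ [Suc e]))" using e by auto
    qed auto
    also have "\<dots> = M v' * (\<Sum>e=0..<0 + (s + 1). Q ! e)"
      using s by (simp add: mass_piece_range[OF np(3)] j Q_def)
    also have "\<dots> \<le> M v' * (6 * edge_const ^ 5 * Q ! 0)" using s s6
      by (intro mult_left_mono ends) auto
    finally have 1: "mass {lo v'..<lo v' + gap k} \<le> M v' * (6 * edge_const ^ 5 * Q ! 0)" .
    have hv: "hi v = lo v + real (n j - 1) * pitch j + len j"
      using len_split[of "k + t"] branches[of "k + t"] lv j
        by (simp add: hi_def pitch_def of_nat_diff algebra_simps)
    have "mass {hi v - gap k<..hi v} \<le> mass (\<Union>e\<in>{n j - (s + 1)..<n j}. cyl n c (v @ [Suc e]))"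
    proof (rule mass_mono)
      fix y assume y: "y \<in> E" "y \<in> {hi v - gap k<..hi v}"
      then have "y \<in> cyl n c v" using g3 by (auto simp: cyl_eq hi_def lv)
      then obtain e where e: "e < n j" "y \<in> cyl n c (v @ [Suc e])"
        using E_piece[OF y(1) np(2)] j by blast
      have "real (n j - 1) * pitch j < real e * pitch j + (real s + 1) * pitch j"
        using pos_in_piece(2)[OF lv(1) e(2)] y(2) g1 hv by (auto simp: j)
      then have "real (n j - 1) * pitch j < real (e + s + 1) * pitch j"
        by (simp add: algebra_simps)
      then have "n j - 1 < e + s + 1" using p
        by (simp only: mult_less_cancel_right_pos of_nat_less_iff)
      then show "y \<in> (\<Union>e\<in>{n j - (s + 1)..<n j}. cyl n c (v @ [Suc e]))" using e by auto
    qed auto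
    also have "\<dots> = M v * (\<Sum>e=n j - (s + 1)..<n j - (s + 1) + (s + 1). Q ! e)"
      using s by (simp add: mass_piece_range[OF np(2)] j Q_def)
    also have "\<dots> \<le> M v * (6 * edge_const ^ 5 * Q ! (n j - 1))" using s s6
      by (intro mult_left_mono ends) auto
    finally have 2: "mass {hi v - gap k<..hi v} \<le> M v * (6 * edge_const ^ 5 * Q ! (n j - 1))" .
    have e: "M (v @ [n j]) \<le> D ^ 2 * mass {lo v'..<lo v' + gap k}"
      "M (v' @ [Suc 0]) \<le> D ^ 2 * mass {hi v - gap k<..hi v}"
      using edge_pieces_le_gap_balls[OF nb] g3 by (auto simp: j)
    have "D ^ 2 * mass {lo v'..<lo v' + gap k} \<le> D ^ 2 * (M v' * (6 * edge_const ^ 5 * Q ! 0))"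
      "D ^ 2 * mass {hi v - gap k<..hi v} \<le> D ^ 2 * (M v * (6 * edge_const ^ 5 * Q ! (n j - 1)))"
      using 1 2 by (auto intro!: mult_left_mono)
    then show ?thesis using e unfolding Mv by (simp add: mult_ac)
  qed
  have "1 * edge_const ^ 1 \<le> (6 * D ^ 2) * edge_const ^ 5" using K1
    by (intro mult_mono power_increasing) auto
  then have "edge_const \<le> 6 * D ^ 2 * edge_const ^ 5" by simp
  then show ?thesis unfolding s_def[symmetric]
    using s g2 middle t by (intro uniform_append_if_doubling[OF kL nb _ j]) auto
qed

lemma uniform_data_if_doubling:
  "\<exists>C>1. C_uniform_seq C P \<and>
      (\<forall>k\<in>Lambda n c.
        (\<forall>t. 1 \<le> t \<and> t < m_idx n c k \<longrightarrow> C_uniform C (P (k + t) @ P (k + t))) \<and>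
        Cs_uniform C (s_idx n c k) (P (k + m_idx n c k) @ P (k + m_idx n c k)))"
proof -
  define A1 where "A1 = D ^ 6 * edge_const ^ 5"
  define A2 where "A2 = edge_const ^ 2 * (D ^ 6 * edge_const ^ 5)"
  define A3 where "A3 = edge_const ^ 2 * (D ^ 6 * (6 * D ^ 2 * edge_const ^ 5) ^ 5)"
  have "A1 \<ge> 0" "A2 \<ge> 0" "A3 \<ge> 0" using D edge_const_ge by (auto simp: A1_def A2_def A3_def)
  then obtain C where C: "C > 1" "A1 \<le> C" "A2 \<le> C" "A3 \<le> C"
    by (intro that[of "2 + A1 + A2 + A3"]) auto
  have "C_uniform C (P k)" if "k \<ge> 1" for k
    using uniform_if_doubling[of "k - 1", folded A1_def] that C Cs_uniform_mono
      unfolding C_uniform_def by fastforce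
  moreover have "C_uniform C (P (k + t) @ P (k + t))" if "k \<in> Lambda n c" "1 \<le> t"
    "t < m_idx n c k" for k t
    using uniform_append_below[OF that, folded A2_def] C Cs_uniform_mono
      unfolding C_uniform_def by blast
  moreover have "Cs_uniform C (s_idx n c k) (P (k + m_idx n c k) @ P (k + m_idx n c k))"
    if "k \<in> Lambda n c" for k
    using uniform_append_at[OF that, folded A3_def] C Cs_uniform_mono by blast
  ultimately show ?thesis using C(1) unfolding C_uniform_seq_def by blast
qed

end

end

end

section \<open>The equivalence\<close>

theorem corollary2:
  fixes n :: "nat \<Rightarrow> nat" and c :: "nat \<Rightarrow> real" and P :: "nat \<Rightarrow> real list"
    and \<mu> :: "real measure"
  assumes "uniform_cantor_data n c"
    and "\<forall>k\<ge>1. positive_prob_vector (P k)"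
    and "matching n P"
    and "is_cantor_measure n c P \<mu>"
    and "bdd_above (m_idx n c ` Lambda n c)"
  shows "doubling_on (cantor_set n c) \<mu> \<longleftrightarrow>
    (\<exists>C::real. C > 1 \<and> C_uniform_seq C P \<and>
      (\<forall>k\<in>Lambda n c.
        (\<forall>t. 1 \<le> t \<and> t < m_idx n c k \<longrightarrow> C_uniform C (P (k + t) @ P (k + t))) \<and>
        Cs_uniform C (s_idx n c k) (P (k + m_idx n c k) @ P (k + m_idx n c k))))"
proof -
  interpret cantor_measure n c P \<mu>
    by unfold_locales (use assms in auto)
  obtain m where m: "\<And>k. k \<in> Lambda n c \<Longrightarrow> m_idx n c k \<le> m"
    using assms(5) by (auto simp: bdd_above_def)
  show ?thesis
  proof
    assume "doubling_on (cantor_set n c) \<mu>"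
    then obtain D where "D \<ge> 1"
      "\<And>x r. x \<in> E \<Longrightarrow> r > 0 \<Longrightarrow> mass (ball x (2 * r)) \<le> D * mass (ball x r)"
      unfolding doubling_iff by blast
    then show "\<exists>C>1. C_uniform_seq C P \<and>
      (\<forall>k\<in>Lambda n c.
        (\<forall>t. 1 \<le> t \<and> t < m_idx n c k \<longrightarrow> C_uniform C (P (k + t) @ P (k + t))) \<and>
        Cs_uniform C (s_idx n c k) (P (k + m_idx n c k) @ P (k + m_idx n c k)))"
      using m by (rule uniform_data_if_doubling)
  next
    assume "\<exists>C>1. C_uniform_seq C P \<and>
      (\<forall>k\<in>Lambda n c.
        (\<forall>t. 1 \<le> t \<and> t < m_idx n c k \<longrightarrow> C_uniform C (P (k + t) @ P (k + t))) \<and>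
        Cs_uniform C (s_idx n c k) (P (k + m_idx n c k) @ P (k + m_idx n c k)))"
    then show "doubling_on (cantor_set n c) \<mu>"
      unfolding doubling_iff using doubling_if_uniform m by blast
  qed
qed

end
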